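(* Let $\mathcal{G}=(G,i)$ be a partitioned graph. If $\mathcal{G}$ is pre-Lorentzian, then the independence sequence of $G$ is log-concave.
   Context: All graphs are finite, simple and undirected. A subset of vertices is independent if it contains no two adjacent vertices. The independence sequence of $G$ is $(i_0,\dots,i_d)$, where $i_k$ is the number of independent sets of cardinality $k$ and $d$ is the maximal cardinality of an independent set. A non-negative sequence $(s_0,\dots,s_n)$ is log-concave if $s_k^2\ge s_{k-1}s_{k+1}$ for all $k\in\{1,\dots,n-1\}$. Coloured and partitioned graphs. A coloured graph is a pair $(G,i)$ with $G$ a graph and $i$ a map from $V(G)$ to a set of colours (not required to be a proper colouring). A vertex, and its colour, is free if no other vertex has the same colour. A partitioned graph is a coloured graph with a distinguished colour, the bound colour, such that every colour other than the bound colour is free. Coloured independence polynomial. For a coloured graph $\mathcal{G}=(G,i)$, $\mathrm{C}(\mathcal{G})=\sum_{S}\prod_{v\in S}x_{i(v)}$, the sum being over all independent sets $S\subseteq V(G)$. Homogenisation. For a polynomial $p$ in $x_1,\dots,x_n$, $\mathrm{H}(p)$ is the homogeneous polynomial in $x_1,\dots,x_n,y$ of minimal degree with $\mathrm{H}(p)|_{y=1}=p$; $y$ is the homogenising variable. Lorentzian polynomials. A finite set $A\subset\mathbb{Z}^n$ is M-convex if for all $\alpha,\beta\in A$ and every index $i$ with $\alpha_i>\beta_i$ there is an index $j$ with $\beta_j>\alpha_j$ and $\alpha-e_i+e_j\in A$, where $e_i$ is the $i$th standard basis vector. The support of $p=\sum_\alpha c_\alpha x^\alpha$ is $\{\alpha: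 c_\alpha\neq0\}$. A homogeneous real polynomial $p$ of degree $d$ with non-negative coefficients is Lorentzian if its support is M-convex and, for every partial derivative of $p$ of order $d-2$, the corresponding Hessian matrix has at most one positive eigenvalue. Pre-Lorentzian. A partitioned graph $\mathcal{G}$ is pre-Lorentzian if there exists $k\in\mathbb{N}$ such that $(xy)^k\cdot\mathrm{H}(\mathrm{C}(\mathcal{G}))$ is Lorentzian, where $x$ is the variable of the bound colour and $y$ is the homogenising variable. *)

theory Defs
  imports
    "HOL-Library.Poly_Mapping"
    "HOL-Computational_Algebra.Polynomial"
    "Jordan_Normal_Form.Char_Poly"
begin

section \<open>Graphs and independence sequences\<close>

definition simple_graph :: "'v set \<Rightarrow> 'v set set \<Rightarrow> bool" where
  "simple_graph V E \<longleftrightarrow> finite V \<and> (\<forall>e\<in>E. e \<subseteq> V \<and> card e = 2)"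

definition independent_sets :: "'v set \<Rightarrow> 'v set set \<Rightarrow> 'v set set" where
  "independent_sets V E = {S. S \<subseteq> V \<and> (\<forall>u\<in>S. \<forall>v\<in>S. {u, v} \<notin> E)}"

definition independence_number :: "'v set \<Rightarrow> 'v set set \<Rightarrow> nat" where
  "independence_number V E = Max (card ` independent_sets V E)"

definition independence_sequence :: "'v set \<Rightarrow> 'v set set \<Rightarrow> real list" where
  "independence_sequence V E =
     map (\<lambda>k. real (card {S \<in> independent_sets V E. card S = k}))
       [0..<Suc (independence_number V E)]"

definition log_concave :: "real list \<Rightarrow> bool" where
  "log_concave s \<longleftrightarrow>
     (\<forall>x\<in>set s. 0 \<le> x) \<and>
     (\<forall>k. 1 \<le> k \<and> Suc k < length s \<longrightarrow> (s ! k)\<^sup>2 \<ge> s ! (k - 1) * s ! (k + 1))"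


section \<open>Coloured and partitioned graphs\<close>

text \<open>The colouring is a total function on the type of vertices, but only its values on \<open>V\<close>
  matter.\<close>

definition free_vertex :: "'v set \<Rightarrow> ('v \<Rightarrow> 'c) \<Rightarrow> 'v \<Rightarrow> bool" where
  "free_vertex V i v \<longleftrightarrow> v \<in> V \<and> (\<forall>w\<in>V. i w = i v \<longrightarrow> w = v)"

definition partitioned_graph :: "'v set \<Rightarrow> 'v set set \<Rightarrow> ('v \<Rightarrow> 'c) \<Rightarrow> 'c \<Rightarrow> bool" where
  "partitioned_graph V E i b \<longleftrightarrow>
     simple_graph V E \<and> (\<forall>v\<in>V. i v \<noteq> b \<longrightarrow> free_vertex V i v)"


section \<open>Polynomials in several variables\<close>

text \<open>A monomial is its exponent vector, and a polynomial maps monomials to coefficients.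
  The ring structure is the convolution product of \<^theory>\<open>HOL-Library.Poly_Mapping\<close>.\<close>

type_synonym 'x mon = "'x \<Rightarrow>\<^sub>0 nat"
type_synonym 'x polynomial = "'x mon \<Rightarrow>\<^sub>0 real"

definition var :: "'x \<Rightarrow> 'x polynomial" where
  "var x = Poly_Mapping.single (Poly_Mapping.single x 1) 1"

definition mon_degree :: "'x mon \<Rightarrow> nat" where
  "mon_degree m = (\<Sum>x\<in>Poly_Mapping.keys m. Poly_Mapping.lookup m x)"

definition homogeneous :: "nat \<Rightarrow> 'x polynomial \<Rightarrow> bool" where
  "homogeneous d p \<longleftrightarrow> (\<forall>m\<in>Poly_Mapping.keys p. mon_degree m = d)"

definition substitute :: "('x \<Rightarrow> 'z polynomial) \<Rightarrow> 'x polynomial \<Rightarrow> 'z polynomial" where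
  "substitute s p =
     (\<Sum>m\<in>Poly_Mapping.keys p. Poly_Mapping.single 0 (Poly_Mapping.lookup p m) *
        (\<Prod>x\<in>Poly_Mapping.keys m. s x ^ Poly_Mapping.lookup m x))"

text \<open>If \<open>x\<close> does not occur in the monomial \<open>m\<close>, the truncated subtraction leaves \<open>m\<close> unchanged,
  but the new coefficient vanishes.\<close>

definition partial_derivative :: "'x \<Rightarrow> 'x polynomial \<Rightarrow> 'x polynomial" where
  "partial_derivative x p =
     (\<Sum>m\<in>Poly_Mapping.keys p. Poly_Mapping.single (m - Poly_Mapping.single x 1)
        (of_nat (Poly_Mapping.lookup m x) * Poly_Mapping.lookup p m))"

definition coloured_independence_polynomial ::
    "'v set \<Rightarrow> 'v set set \<Rightarrow> ('v \<Rightarrow> 'c) \<Rightarrow> 'c polynomial" where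
  "coloured_independence_polynomial V E i =
     (\<Sum>S\<in>independent_sets V E. \<Prod>v\<in>S. var (i v))"


section \<open>Homogenisation\<close>

text \<open>In a polynomial over \<^typ>\<open>'c option\<close>, the variable \<^const>\<open>None\<close> is the homogenising
  variable \<open>y\<close> and \<open>Some c\<close> is the original variable \<open>c\<close>.\<close>

definition set_y_to_1 :: "'c option polynomial \<Rightarrow> 'c polynomial" where
  "set_y_to_1 = substitute (case_option 1 var)"

definition homogeneous_lift :: "'c polynomial \<Rightarrow> nat \<Rightarrow> 'c option polynomial \<Rightarrow> bool" where
  "homogeneous_lift p d q \<longleftrightarrow> homogeneous d q \<and> set_y_to_1 q = p"

definition is_homogenisation :: "'c polynomial \<Rightarrow> 'c option polynomial \<Rightarrow> bool" where
  "is_homogenisation p q \<longleftrightarrow>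
     (\<exists>d. homogeneous_lift p d q \<and> (\<forall>d' q'. homogeneous_lift p d' q' \<longrightarrow> d \<le> d'))"

definition homogenisation :: "'c polynomial \<Rightarrow> 'c option polynomial" where
  "homogenisation p = (THE q. is_homogenisation p q)"


section \<open>Lorentzian polynomials\<close>

text \<open>Only exponent vectors are needed, so sets of non-negative integer vectors suffice.
  The subtraction is never truncated, because \<open>\<alpha>\<close> is positive at \<open>i\<close>.\<close>

definition M_convex :: "'x mon set \<Rightarrow> bool" where
  "M_convex A \<longleftrightarrow> finite A \<and>
     (\<forall>\<alpha>\<in>A. \<forall>\<beta>\<in>A. \<forall>i. Poly_Mapping.lookup \<alpha> i > Poly_Mapping.lookup \<beta> i \<longrightarrow>
        (\<exists>j. Poly_Mapping.lookup \<beta> j > Poly_Mapping.lookup \<alpha> j \<and>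
             \<alpha> - Poly_Mapping.single i 1 + Poly_Mapping.single j 1 \<in> A))"

text \<open>Only used for \<open>q\<close> homogeneous of degree 2, whose second partial derivatives are constant:
  the entries are the constant coefficients of these derivatives. The list \<open>xs\<close> enumerates the
  variables.\<close>

definition hessian :: "'x list \<Rightarrow> 'x polynomial \<Rightarrow> real mat" where
  "hessian xs q = mat (length xs) (length xs)
     (\<lambda>(i, j). Poly_Mapping.lookup
        (partial_derivative (xs ! i) (partial_derivative (xs ! j) q)) 0)"

text \<open>Eigenvalues are counted with multiplicity.\<close>

definition at_most_one_positive_eigenvalue :: "real mat \<Rightarrow> bool" where
  "at_most_one_positive_eigenvalue A \<longleftrightarrow>
     size (filter_mset (\<lambda>t. t > 0) (proots (char_poly A))) \<le> 1"

text \<open>The finite set \<open>X\<close> contains all variables of \<open>p\<close>; the order in which \<open>xs\<close> lists them is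
  immaterial, as it changes Hessians only by a simultaneous permutation of rows and columns.
  The list \<open>zs\<close> runs through the partial derivatives of order \<open>d - 2\<close>; there are none if
  \<open>d < 2\<close>.\<close>

definition lorentzian :: "'x set \<Rightarrow> 'x polynomial \<Rightarrow> bool" where
  "lorentzian X p \<longleftrightarrow>
     (\<forall>m\<in>Poly_Mapping.keys p. Poly_Mapping.keys m \<subseteq> X) \<and>
     (\<exists>d xs. distinct xs \<and> set xs = X \<and>
        homogeneous d p \<and>
        (\<forall>m. 0 \<le> Poly_Mapping.lookup p m) \<and>
        M_convex (Poly_Mapping.keys p) \<and>
        (\<forall>zs. set zs \<subseteq> X \<and> length zs + 2 = d \<longrightarrow>
           at_most_one_positive_eigenvalue (hessian xs (fold partial_derivative zs p))))"

text \<open>The variables are the bound colour, the colours that are used, and \<open>y\<close>.\<close>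

definition pre_lorentzian :: "'v set \<Rightarrow> 'v set set \<Rightarrow> ('v \<Rightarrow> 'c) \<Rightarrow> 'c \<Rightarrow> bool" where
  "pre_lorentzian V E i b \<longleftrightarrow>
     (\<exists>k. lorentzian (insert None (Some ` insert b (i ` V)))
            ((var (Some b) * var None) ^ k *
               homogenisation (coloured_independence_polynomial V E i)))"


section \<open>Well-definedness of the homogenisation\<close>

lemma lookup_map_key_Some [simp]:
  "Poly_Mapping.lookup (Poly_Mapping.map_key Some n) c = Poly_Mapping.lookup n (Some c)"
  by (simp add: map_key.rep_eq)

lemma mon_degree_superset:
  assumes "finite A" "Poly_Mapping.keys m \<subseteq> A"
  shows "mon_degree m = (\<Sum>x\<in>A. Poly_Mapping.lookup m x)"
  unfolding mon_degree_def using assms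
  by (intro sum.mono_neutral_left) (auto simp: in_keys_iff)

lemma mon_degree_add: "mon_degree (m + n) = mon_degree m + mon_degree n"
proof -
  let ?A = "Poly_Mapping.keys m \<union> Poly_Mapping.keys n"
  have "mon_degree (m + n) = (\<Sum>x\<in>?A. Poly_Mapping.lookup (m + n) x)"
    by (intro mon_degree_superset) (use Poly_Mapping.keys_add[of m n] in auto)
  then show ?thesis
    by (simp add: lookup_add sum.distrib mon_degree_superset[of ?A m] mon_degree_superset[of ?A n])
qed

lemma mon_degree_single [simp]: "mon_degree (Poly_Mapping.single x k) = k"
  by (simp add: mon_degree_def)

lemma mon_degree_option:
  "mon_degree n = Poly_Mapping.lookup n None + mon_degree (Poly_Mapping.map_key Some n)"
proof -
  let ?B = "Poly_Mapping.keys (Poly_Mapping.map_key Some n)"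
  have "Poly_Mapping.keys n \<subseteq> insert None (Some ` ?B)"
  proof
    fix x assume "x \<in> Poly_Mapping.keys n"
    then show "x \<in> insert None (Some ` ?B)"
      by (cases x) (auto simp: in_keys_iff)
  qed
  then have "mon_degree n = (\<Sum>x\<in>insert None (Some ` ?B). Poly_Mapping.lookup n x)"
    by (intro mon_degree_superset) auto
  then show ?thesis
    by (simp add: sum.insert sum.reindex mon_degree_def image_iff)
qed

lemma mon_option_eqI:
  assumes "Poly_Mapping.map_key Some n = Poly_Mapping.map_key Some n'"
    and "mon_degree n = mon_degree n'"
  shows "n = n'"
proof (rule poly_mapping_eqI)
  fix x
  show "Poly_Mapping.lookup n x = Poly_Mapping.lookup n' x"
    using assms mon_degree_option[of n] mon_degree_option[of n']
    by (cases x) (simp, metis lookup_map_key_Some)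
qed

lemma var_power: "var x ^ k = Poly_Mapping.single (Poly_Mapping.single x k) 1"
  by (induction k)
    (simp_all add: var_def mult_single single_add[symmetric] flip: single_one)

lemma prod_single:
  "finite A \<Longrightarrow> (\<Prod>x\<in>A. Poly_Mapping.single (f x) (1 :: real)) = Poly_Mapping.single (\<Sum>x\<in>A. f x) 1"
  by (induction A rule: finite_induct) (simp_all add: mult_single)

lemma substitute_monomial:
  "(\<Prod>x\<in>Poly_Mapping.keys n. case_option 1 var x ^ Poly_Mapping.lookup n x) =
     Poly_Mapping.single (Poly_Mapping.map_key Some n) 1"
proof -
  let ?f = "\<lambda>x. case x of None \<Rightarrow> 0 | Some c \<Rightarrow> Poly_Mapping.single c (Poly_Mapping.lookup n x)"
  have "(\<Prod>x\<in>Poly_Mapping.keys n. case_option 1 var x ^ Poly_Mapping.lookup n x) =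
      (\<Prod>x\<in>Poly_Mapping.keys n. Poly_Mapping.single (?f x) 1)"
    by (intro prod.cong) (auto simp: var_power split: option.split)
  also have "\<dots> = Poly_Mapping.single (\<Sum>x\<in>Poly_Mapping.keys n. ?f x) 1"
    by (rule prod_single) simp
  also have "(\<Sum>x\<in>Poly_Mapping.keys n. ?f x) = Poly_Mapping.map_key Some n"
  proof (rule poly_mapping_eqI)
    fix c
    have "Poly_Mapping.lookup (\<Sum>x\<in>Poly_Mapping.keys n. ?f x) c =
        (\<Sum>x\<in>Poly_Mapping.keys n. if x = Some c then Poly_Mapping.lookup n x else 0)"
      unfolding lookup_sum
      by (intro sum.cong) (auto simp: lookup_single when_def split: option.split)
    then show "Poly_Mapping.lookup (\<Sum>x\<in>Poly_Mapping.keys n. ?f x) c =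
        Poly_Mapping.lookup (Poly_Mapping.map_key Some n) c"
      by (simp add: in_keys_iff)
  qed
  finally show ?thesis .
qed

lemma set_y_to_1_eq:
  "set_y_to_1 q = (\<Sum>n\<in>Poly_Mapping.keys q.
     Poly_Mapping.single (Poly_Mapping.map_key Some n) (Poly_Mapping.lookup q n))"
  unfolding set_y_to_1_def substitute_def substitute_monomial by (simp add: mult_single)

lemma lookup_set_y_to_1:
  assumes "homogeneous d q" "mon_degree n = d"
  shows "Poly_Mapping.lookup (set_y_to_1 q) (Poly_Mapping.map_key Some n) = Poly_Mapping.lookup q n"
proof -
  have "Poly_Mapping.lookup (set_y_to_1 q) (Poly_Mapping.map_key Some n) =
      (\<Sum>n'\<in>Poly_Mapping.keys q. if n' = n then Poly_Mapping.lookup q n' else 0)"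
    unfolding set_y_to_1_eq lookup_sum
    using assms by (intro sum.cong) (auto simp: lookup_single when_def homogeneous_def dest: mon_option_eqI)
  then show ?thesis by (simp add: in_keys_iff)
qed

lemma homogeneous_lift_unique:
  assumes "homogeneous_lift p d q" "homogeneous_lift p d q'"
  shows "q = q'"
proof (rule poly_mapping_eqI)
  fix n
  show "Poly_Mapping.lookup q n = Poly_Mapping.lookup q' n"
  proof (cases "mon_degree n = d")
    case True
    then show ?thesis
      using assms unfolding homogeneous_lift_def by (metis lookup_set_y_to_1)
  next
    case False
    then show ?thesis
      using assms unfolding homogeneous_lift_def homogeneous_def by (metis in_keys_iff)
  qed
qed

lemma homogeneous_lift_exists:
  fixes p :: "'c polynomial"
  shows "\<exists>d q. homogeneous_lift p d q"
proof -
  define d where "d = Max (insert 0 (mon_degree ` Poly_Mapping.keys p))"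
  have le: "mon_degree m \<le> d" if "m \<in> Poly_Mapping.keys p" for m
    unfolding d_def using that by (intro Max_ge) auto
  define h where "h m = (\<Sum>c\<in>Poly_Mapping.keys m. Poly_Mapping.single (Some c) (Poly_Mapping.lookup m c))
      + Poly_Mapping.single None (d - mon_degree m)" for m :: "'c mon"
  have key: "Poly_Mapping.map_key Some (h m) = m" for m
  proof (rule poly_mapping_eqI)
    fix c
    have "Poly_Mapping.lookup (Poly_Mapping.map_key Some (h m)) c =
        (\<Sum>c'\<in>Poly_Mapping.keys m. if c' = c then Poly_Mapping.lookup m c' else 0)"
      unfolding lookup_map_key_Some h_def lookup_add lookup_sum
      by (simp add: lookup_single when_def)
    then show "Poly_Mapping.lookup (Poly_Mapping.map_key Some (h m)) c = Poly_Mapping.lookup m c"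
      by (simp add: in_keys_iff)
  qed
  have None: "Poly_Mapping.lookup (h m) None = d - mon_degree m" for m
    by (simp add: h_def lookup_add lookup_sum lookup_single when_def)
  have deg: "mon_degree (h m) = d" if "m \<in> Poly_Mapping.keys p" for m
    using le[OF that] mon_degree_option[of "h m"] by (simp add: key None)
  define q where "q = (\<Sum>m\<in>Poly_Mapping.keys p. Poly_Mapping.single (h m) (Poly_Mapping.lookup p m))"
  have inj: "h m = h m' \<longleftrightarrow> m = m'" for m m'
    by (metis key)
  have lookup_q: "Poly_Mapping.lookup q (h m) = Poly_Mapping.lookup p m" for m
    unfolding q_def lookup_sum
    by (simp add: lookup_single when_def inj in_keys_iff)
  have keys_q: "Poly_Mapping.keys q = h ` Poly_Mapping.keys p"
  proof
    show "Poly_Mapping.keys q \<subseteq> h ` Poly_Mapping.keys p"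
      unfolding q_def by (rule order_trans[OF Poly_Mapping.keys_sum]) (auto split: if_splits)
    show "h ` Poly_Mapping.keys p \<subseteq> Poly_Mapping.keys q"
      by (auto simp: in_keys_iff lookup_q)
  qed
  have "set_y_to_1 q = (\<Sum>m\<in>Poly_Mapping.keys p. Poly_Mapping.single m (Poly_Mapping.lookup p m))"
    unfolding set_y_to_1_eq keys_q
    by (subst sum.reindex) (auto simp: inj_on_def inj key lookup_q)
  also have "\<dots> = p"
    by (rule poly_mapping_eqI) (simp add: lookup_sum lookup_single when_def in_keys_iff)
  finally have "homogeneous_lift p d q"
    unfolding homogeneous_lift_def homogeneous_def keys_q using deg by auto
  then show ?thesis by blast
qed

lemma is_homogenisation_ex1: "\<exists>!q. is_homogenisation p q"
proof -
  define d where "d = (LEAST d. \<exists>q. homogeneous_lift p d q)"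
  have "\<exists>q. homogeneous_lift p d q"
    unfolding d_def by (rule LeastI_ex) (rule homogeneous_lift_exists)
  then obtain q where q: "homogeneous_lift p d q" ..
  have "d \<le> d'" if "homogeneous_lift p d' q'" for d' q'
    unfolding d_def using that by (intro Least_le) blast
  then have "is_homogenisation p q"
    unfolding is_homogenisation_def using q by blast
  then show ?thesis
    unfolding is_homogenisation_def by (metis homogeneous_lift_unique order_antisym)
qed

lemma is_homogenisation_homogenisation: "is_homogenisation p (homogenisation p)"
  unfolding homogenisation_def by (rule theI') (rule is_homogenisation_ex1)

end

theory Submission
  imports Defs "HOL-Analysis.Function_Topology"
begin

text \<open>
  Give every colour other than the homogenising variable \<open>y\<close> the same value \<open>x\<close>. This turns
  \<open>p = (x y)\<^sup>k H(C)\<close> into a homogeneous polynomial in \<open>x\<close> and \<open>y\<close> of some degree \<open>n\<close>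
  whose coefficients are the numbers of independent sets. If \<open>c\<^sub>b\<close> is the coefficient at \<open>y\<^sup>b\<close>,
  then applying the derivative \<open>\<partial>\<^sub>x\<close> \<open>a\<close> times and \<open>\<partial>\<^sub>y\<close> \<open>b = n - a\<close> times yields
  \<open>a! b! c\<^sub>b\<close>. Now \<open>\<partial>\<^sub>x\<close> of the specialisation is the derivative of \<open>p\<close> in the direction of
  the sum of all basis vectors except that of \<open>y\<close>. So what has to be shown is that iterated
  derivatives of a Lorentzian polynomial in non-negative directions satisfy the inequality
  \<open>(\<partial>\<^sub>u \<partial>\<^sub>v \<partial>\<^sub>w \<dots> p)\<^sup>2 \<ge> (\<partial>\<^sub>u \<partial>\<^sub>u \<partial>\<^sub>w \<dots> p) (\<partial>\<^sub>v \<partial>\<^sub>v \<partial>\<^sub>w \<dots> p)\<close>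
  (lemma \<open>directional_log_concave\<close>); the factors \<open>a! b!\<close> are themselves log-convex and can be
  dropped afterwards.

  A symmetric matrix with at most one positive eigenvalue satisfies the reversed Cauchy-Schwarz
  inequality; call such a form hyperbolic. By definition the Hessians of all the derivatives of
  order \<open>n - 2\<close> in coordinate directions are hyperbolic, and the task is to pass to arbitrary
  positive directions. This is done one direction at a time (lemma \<open>hyperbolic_directional\<close>),
  by a spectral argument that trickles down from the derivatives \<open>\<partial>\<^sub>l p\<close> to \<open>p\<close> (lemma
  \<open>trickle_down\<close>). For a positive vector \<open>w\<close> the Hessian \<open>H\<close> of \<open>\<partial>\<^sub>w \<dots> p\<close> is the sum
  of the Hessians \<open>H\<^sub>l\<close> of \<open>\<partial>\<^sub>l \<dots> p\<close>, weighted with \<open>w\<^sub>l\<close>. The symmetry of third derivatives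
  gives \<open>w\<^sup>T H\<^sub>l v = (H v)\<^sub>l\<close>, so the reversed Cauchy-Schwarz inequality for each \<open>H\<^sub>l\<close>
  adds up to \<open>H \<le> H D\<^sup>-\<^sup>1 H\<close>, where \<open>D\<close> is the diagonal matrix with \<open>H w = D w\<close>. Hence
  every positive eigenvalue of \<open>D\<^sup>-\<^sup>1 H\<close> is at least \<open>1\<close>. But \<open>D\<^sup>-\<^sup>1 H\<close> is non-negative with
  the positive eigenvector \<open>w\<close> of eigenvalue \<open>1\<close>, so no eigenvalue exceeds \<open>1\<close>, and
  the eigenvalue \<open>1\<close> is simple if \<open>H\<close> is irreducible. Irreducibility is what M-convexity of the
  support provides (lemma \<open>M_convex_mixed_monomial\<close>).

  Non-negative directions are limits of positive ones.
\<close>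

section \<open>Hyperbolic forms\<close>

definition bform :: "'x set \<Rightarrow> ('x \<Rightarrow> 'x \<Rightarrow> real) \<Rightarrow> ('x \<Rightarrow> real) \<Rightarrow> ('x \<Rightarrow> real) \<Rightarrow> real" where
  "bform X h u v = (\<Sum>i\<in>X. \<Sum>j\<in>X. u i * v j * h i j)"

lemma bform_commute:
  assumes "\<And>i j. h i j = h j i"
  shows "bform X h u v = bform X h v u"
  unfolding bform_def by (subst sum.swap) (simp add: assms mult_ac)

lemma bform_add_scale_right:
  "bform X h u (\<lambda>i. v i + c * w i) = bform X h u v + c * bform X h u w"
  unfolding bform_def by (simp add: algebra_simps sum.distrib sum_distrib_left)

lemma bform_add_scale_left:
  "bform X h (\<lambda>i. v i + c * w i) u = bform X h v u + c * bform X h w u"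
  unfolding bform_def by (simp add: algebra_simps sum.distrib sum_distrib_left)

lemma bform_square:
  assumes "\<And>i j. h i j = h j i"
  shows "bform X h (\<lambda>i. v i + c * w i) (\<lambda>i. v i + c * w i) =
     bform X h v v + 2 * c * bform X h v w + c\<^sup>2 * bform X h w w"
  unfolding bform_add_scale_left bform_add_scale_right bform_commute[of h X w v, OF assms]
  by (simp add: power2_eq_square algebra_simps)

lemma bform_eq_row:
  "bform X h u v = (\<Sum>i\<in>X. u i * (\<Sum>j\<in>X. h i j * v j))"
  unfolding bform_def by (simp add: sum_distrib_left mult_ac)

text \<open>For a symmetric form this says that at most one eigenvalue is positive, in a way that does not
  refer to eigenvalues and survives limits and changes of basis.\<close>
definition hyperbolic :: "'x set \<Rightarrow> ('x \<Rightarrow> 'x \<Rightarrow> real) \<Rightarrow> bool" where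
  "hyperbolic X h \<longleftrightarrow>
     (\<forall>u v. 0 < bform X h u u \<longrightarrow> bform X h u u * bform X h v v \<le> (bform X h u v)\<^sup>2)"

text \<open>If \<open>u\<close> is a positive vector, then some combination \<open>v + c u\<close> lies in the hyperplane, and the
  form is non-positive there. Completing the square in \<open>c\<close> gives the reversed
  Cauchy-Schwarz inequality.\<close>
lemma hyperbolicI_hyperplane:
  assumes sym: "\<And>i j. h i j = h j i"
    and le: "\<And>z. (\<Sum>i\<in>X. g i * z i) = 0 \<Longrightarrow> bform X h z z \<le> 0"
  shows "hyperbolic X h"
  unfolding hyperbolic_def
proof (intro allI impI)
  fix u v
  let ?B = "bform X h" and ?f = "\<lambda>z. \<Sum>i\<in>X. g i * z i"
  assume u: "0 < ?B u u"
  then have "?f u \<noteq> 0" using le[of u] by linarith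
  define c where "c = - (?f v / ?f u)"
  have "?f (\<lambda>i. v i + c * u i) = ?f v + c * ?f u"
    by (simp add: algebra_simps sum.distrib sum_distrib_left)
  also have "\<dots> = 0" using \<open>?f u \<noteq> 0\<close> by (simp add: c_def)
  finally have "?B v v + 2 * c * ?B v u + c\<^sup>2 * ?B u u \<le> 0"
    using le[of "\<lambda>i. v i + c * u i"] bform_square[of h X v c u, OF sym] by simp
  then have "?B u u * (?B v v + 2 * c * ?B v u + c\<^sup>2 * ?B u u) \<le> 0"
    using u by (simp add: mult_le_0_iff)
  moreover have "0 \<le> (?B v u + c * ?B u u)\<^sup>2" by simp
  ultimately have "?B u u * ?B v v \<le> (?B v u)\<^sup>2"
    by (simp add: power2_eq_square algebra_simps)
  then show "?B u u * ?B v v \<le> (?B u v)\<^sup>2"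
    by (simp only: bform_commute[of h X u v, OF sym])
qed

lemma linear_term_zero:
  fixes a b :: real
  assumes "\<And>t. 0 \<le> 2 * t * a + t\<^sup>2 * b" and "0 \<le> b"
  shows "a = 0"
proof (rule ccontr)
  assume "a \<noteq> 0"
  have "2 * (- a / (b + 1)) * a + (- a / (b + 1))\<^sup>2 * b = - a\<^sup>2 * (b + 2) / (b + 1)\<^sup>2"
    using \<open>0 \<le> b\<close> by (simp add: power2_eq_square divide_simps) (simp add: algebra_simps)
  also have "\<dots> < 0"
    using \<open>a \<noteq> 0\<close> \<open>0 \<le> b\<close> by (simp add: divide_neg_pos)
  finally show False using assms(1)[of "- a / (b + 1)"] by linarith
qed

lemma compact_box_functions:
  fixes S :: "'x \<Rightarrow> real set"
  assumes "\<And>i. compact (S i)"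
  shows "compact {v. \<forall>i. v i \<in> S i}"
proof -
  have "compactin (product_topology (\<lambda>i. euclidean) UNIV) (Pi\<^sub>E UNIV S)"
    using assms by (subst compactin_PiE) simp
  moreover have "Pi\<^sub>E UNIV S = {v. \<forall>i. v i \<in> S i}" by (auto simp: PiE_def)
  ultimately show ?thesis by (simp add: euclidean_product_topology)
qed

lemma continuous_on_coordinate: "continuous_on S (\<lambda>v :: 'x \<Rightarrow> real. v i)"
  by (rule continuous_on_subset[OF continuous_on_product_coordinates]) simp

text \<open>A maximiser of the Rayleigh quotient of \<open>h\<close> relative to the weights \<open>D\<close>, among the vectors
  orthogonal to a given eigenvector \<open>w\<close>, is again an eigenvector, since the orthogonal complement
  is invariant. The case \<open>w = 0\<close> is allowed and yields a largest eigenvalue without any constraint.\<close>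
lemma max_eigenvector:
  fixes h :: "'x \<Rightarrow> 'x \<Rightarrow> real"
  assumes fin: "finite X" and sym: "\<And>i j. h i j = h j i" and D: "\<And>i. i \<in> X \<Longrightarrow> 0 < D i"
    and w: "\<And>i. i \<in> X \<Longrightarrow> (\<Sum>j\<in>X. h i j * w j) = \<mu> * D i * w i"
    and z: "(\<Sum>i\<in>X. D i * w i * z i) = 0" "0 < bform X h z z"
  obtains v r where "0 < r" "\<exists>i\<in>X. v i \<noteq> 0" "(\<Sum>i\<in>X. D i * w i * v i) = 0"
    "\<And>i. i \<in> X \<Longrightarrow> (\<Sum>j\<in>X. h i j * v j) = r * D i * v i"
proof -
  let ?Q = "\<lambda>v. bform X h v v" and ?f = "\<lambda>v. \<Sum>i\<in>X. D i * w i * v i"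
  define N where "N v = (\<Sum>i\<in>X. D i * (v i)\<^sup>2)" for v :: "'x \<Rightarrow> real"
  have N_nonneg: "0 \<le> N v" for v
    unfolding N_def using D by (intro sum_nonneg) (simp add: less_imp_le)
  have N_zero: "N v = 0 \<longleftrightarrow> (\<forall>i\<in>X. v i = 0)" for v
  proof -
    have "N v = 0 \<longleftrightarrow> (\<forall>i\<in>X. D i * (v i)\<^sup>2 = 0)"
      unfolding N_def using fin D by (intro sum_nonneg_eq_0_iff) (simp_all add: less_imp_le)
    also have "\<dots> \<longleftrightarrow> (\<forall>i\<in>X. v i = 0)"
      by (intro ball_cong refl) (use D in force)
    finally show ?thesis .
  qed
  \<comment> \<open>The sphere of the weighted norm has \<open>D i * (v i)\<^sup>2 \<le> 1\<close>; the bound \<open>1 + 1 / D i\<close> avoids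
    square roots. Coordinates outside \<open>X\<close> are set to 0 to make the sphere compact.\<close>
  define K where "K = {v. (\<forall>i. v i \<in> (if i \<in> X then {- (1 + 1 / D i)..1 + 1 / D i} else {0}))
     \<and> N v = 1 \<and> ?f v = 0}"
  have "compact K"
  proof -
    have "compact {v. \<forall>i. v i \<in> (if i \<in> X then {- (1 + 1 / D i)..1 + 1 / D i} else {0 :: real})}"
      by (rule compact_box_functions) simp
    moreover have "closed {v. N v = 1}" "closed {v. ?f v = 0}"
      unfolding N_def by (intro closed_Collect_eq continuous_intros continuous_on_coordinate)+
    ultimately show ?thesis
      unfolding K_def Collect_conj_eq Int_assoc[symmetric] by (intro compact_Int_closed)
  qed
  have scaled: "(\<lambda>i. if i \<in> X then u i / sqrt (N u) else 0) \<in> K" (is "?v \<in> K")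
    and Q_scaled: "?Q (\<lambda>i. if i \<in> X then u i / sqrt (N u) else 0) = ?Q u / N u"
    if f: "?f u = 0" and N: "0 < N u" for u
  proof -
    have N1: "N ?v = 1"
    proof -
      have "N ?v = (\<Sum>i\<in>X. D i * (u i)\<^sup>2 / N u)"
        unfolding N_def[of ?v] using N by (intro sum.cong) (auto simp: power_divide)
      also have "\<dots> = 1" using N unfolding N_def by (simp flip: sum_divide_distrib)
      finally show ?thesis .
    qed
    have "?f ?v = (\<Sum>i\<in>X. D i * w i * u i / sqrt (N u))" by (intro sum.cong) auto
    then have f1: "?f ?v = 0" using f by (simp flip: sum_divide_distrib)
    have bound: "?v i \<in> {- (1 + 1 / D i)..1 + 1 / D i}" if "i \<in> X" for i
    proof -
      have "D i * (?v i)\<^sup>2 \<le> N ?v"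
        unfolding N_def[of ?v] using that D fin
        by (intro member_le_sum[of i X "\<lambda>i. D i * (?v i)\<^sup>2"]) (simp_all add: less_imp_le)
      then have "(?v i)\<^sup>2 \<le> 1 / D i" using D[OF that] N1
        by (simp add: pos_le_divide_eq mult.commute)
      also have "\<dots> \<le> 1 + 1 / D i" by simp
      also have "\<dots> \<le> (1 + 1 / D i)\<^sup>2"
        using D[OF that] by (intro self_le_power) simp_all
      finally have "\<bar>?v i\<bar> \<le> \<bar>1 + 1 / D i\<bar>" by (simp only: abs_le_square_iff)
      then show ?thesis using D[OF that] unfolding atLeastAtMost_iff
        by (simp only: abs_le_iff abs_of_pos add_pos_pos zero_less_one divide_pos_pos minus_le_iff simp_thms)
    qed
    have "?v i \<in> (if i \<in> X then {- (1 + 1 / D i)..1 + 1 / D i} else {0})" for i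
      using bound[of i] by (cases "i \<in> X") simp_all
    then show "?v \<in> K" unfolding K_def using N1 f1 by blast
    have "?Q ?v = (\<Sum>i\<in>X. \<Sum>j\<in>X. u i * u j * h i j / N u)"
      unfolding bform_def using N by (intro sum.cong) auto
    then show "?Q ?v = ?Q u / N u" unfolding bform_def by (simp add: sum_divide_distrib)
  qed
  have "0 < N z"
  proof (rule ccontr)
    assume "\<not> 0 < N z"
    then have "\<forall>i\<in>X. z i = 0" using N_zero N_nonneg[of z] by (metis less_eq_real_def)
    then have "?Q z = 0" unfolding bform_def by simp
    with z show False by simp
  qed
  then have "K \<noteq> {}" using scaled z(1) by blast
  moreover have "continuous_on K ?Q"
    unfolding bform_def by (intro continuous_intros continuous_on_coordinate)
  ultimately obtain v where v: "v \<in> K" and max: "\<And>u. u \<in> K \<Longrightarrow> ?Q u \<le> ?Q v"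
    using continuous_attains_sup[OF \<open>compact K\<close>] by blast
  define r where "r = ?Q v"
  have "0 < ?Q z / N z" using z \<open>0 < N z\<close> by simp
  also have "\<dots> \<le> r" unfolding r_def Q_scaled[OF z(1) \<open>0 < N z\<close>, symmetric]
    by (rule max) (rule scaled[OF z(1) \<open>0 < N z\<close>])
  finally have "0 < r" .
  have Nv: "N v = 1" and fv: "?f v = 0" using v unfolding K_def by auto
  have "\<exists>i\<in>X. v i \<noteq> 0" using Nv N_zero[of v] by force

  \<comment> \<open>The form of \<open>r D - h\<close> is non-negative on the complement of \<open>w\<close> and vanishes at \<open>v\<close>,
    so \<open>v\<close> lies in its kernel.\<close>
  define k where "k i j = (if i = j then r * D i else 0) - h i j" for i j
  have k_sym: "k i j = k j i" for i j unfolding k_def using sym by auto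
  have k_row: "(\<Sum>j\<in>X. k i j * u j) = r * D i * u i - (\<Sum>j\<in>X. h i j * u j)" if "i \<in> X" for i u
    unfolding k_def using that fin by (simp add: left_diff_distrib sum_subtractf if_distrib[of "\<lambda>x. x * _"] cong: if_cong)
  have k_form: "bform X k u u = r * N u - ?Q u" for u
    unfolding bform_eq_row N_def
    by (simp add: k_row) (simp add: right_diff_distrib sum_subtractf sum_distrib_left power2_eq_square mult_ac)
  have psd: "0 \<le> bform X k u u" if "?f u = 0" for u
  proof (cases "N u = 0")
    case True
    then have "\<forall>i\<in>X. u i = 0" using N_zero by blast
    then show ?thesis unfolding bform_def by simp
  next
    case False
    then have "0 < N u" using N_nonneg[of u] by simp
    then have "?Q u / N u \<le> r"
      unfolding r_def using max[OF scaled[OF that]] Q_scaled[OF that] by simp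
    then show ?thesis using \<open>0 < N u\<close> by (simp add: k_form field_simps)
  qed
  have ortho: "bform X k v u = 0" if "?f u = 0" for u
  proof (rule linear_term_zero[of _ "bform X k u u"])
    fix t
    have "?f (\<lambda>i. v i + t * u i) = ?f v + t * ?f u"
      by (simp add: algebra_simps sum.distrib sum_distrib_left)
    then have "0 \<le> bform X k (\<lambda>i. v i + t * u i) (\<lambda>i. v i + t * u i)"
      using psd fv that by simp
    also have "\<dots> = bform X k v v + 2 * t * bform X k v u + t\<^sup>2 * bform X k u u"
      by (rule bform_square[OF k_sym])
    also have "bform X k v v = 0" by (simp add: k_form Nv r_def)
    finally show "0 \<le> 2 * t * bform X k v u + t\<^sup>2 * bform X k u u" by simp
  qed (rule psd[OF that])
  have kw: "bform X k v w = 0"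
  proof -
    have "bform X k v w = (\<Sum>i\<in>X. (r - \<mu>) * (D i * w i * v i))"
      unfolding bform_eq_row by (intro sum.cong) (simp_all add: k_row w, simp add: algebra_simps)
    also have "\<dots> = (r - \<mu>) * ?f v" by (simp add: sum_distrib_left)
    finally show ?thesis using fv by simp
  qed
  have zero: "bform X k v u = 0" for u
  proof -
    obtain c where c: "?f u = c * ?f w"
    proof (cases "?f w = 0")
      case True
      have "N w = ?f w" unfolding N_def by (simp add: power2_eq_square mult_ac)
      then have "\<forall>i\<in>X. w i = 0" using True N_zero by simp
      then have "?f u = 0 * ?f w" by simp
      then show ?thesis by (rule that)
    next
      case False
      then have "?f u = ?f u / ?f w * ?f w" by simp
      then show ?thesis by (rule that)
    qed
    have "?f (\<lambda>i. u i + (- c) * w i) = ?f u + (- c) * ?f w"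
      unfolding distrib_left sum.distrib sum_distrib_left by (simp add: mult_ac)
    also have "\<dots> = 0" using c by simp
    finally have "bform X k v (\<lambda>i. u i + (- c) * w i) = 0" by (rule ortho)
    then show ?thesis unfolding bform_add_scale_right using kw by simp
  qed
  have "(\<Sum>j\<in>X. h i j * v j) = r * D i * v i" if "i \<in> X" for i
  proof -
    have "0 = bform X k (\<lambda>j. if j = i then 1 else 0) v" using zero bform_commute[of k X v, OF k_sym] by simp
    also have "\<dots> = (\<Sum>j\<in>X. k i j * v j)"
      unfolding bform_eq_row using fin that by (simp add: if_distrib[of "\<lambda>x. x * _"] cong: if_cong)
    finally show ?thesis using k_row[OF that] by simp
  qed
  with \<open>0 < r\<close> \<open>\<exists>i\<in>X. v i \<noteq> 0\<close> fv show thesis by (rule that)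
qed

section \<open>Hyperbolicity from eigenvalues\<close>

lemma char_poly_root_of_eigenvector:
  fixes A :: "real mat"
  assumes A: "A \<in> carrier_mat n n"
    and y: "\<And>i. i < n \<Longrightarrow> (\<Sum>j<n. A $$ (i, j) * y j) = r * y i" "\<exists>i<n. y i \<noteq> 0"
  shows "poly (char_poly A) r = 0"
proof -
  have "A *\<^sub>v vec n y = r \<cdot>\<^sub>v vec n y"
    using A y(1) by (intro eq_vecI) (auto simp: scalar_prod_def atLeast0LessThan)
  moreover have "vec n y \<noteq> 0\<^sub>v n"
    using y(2) by (metis index_vec index_zero_vec(1))
  ultimately have "eigenvector A (vec n y) r"
    using A unfolding eigenvector_def by auto
  then have "eigenvalue A r" unfolding eigenvalue_def by blast
  then show ?thesis using eigenvalue_root_char_poly[OF A] by simp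
qed

text \<open>Some combination of the two eigenvectors vanishes at any prescribed index \<open>k\<close>, so it is still an
  eigenvector after row and column \<open>k\<close> are deleted. Hence \<open>r\<close> is a root of the characteristic
  polynomials of all these principal submatrices, and their sum is the derivative of the
  characteristic polynomial.\<close>
lemma char_poly_double_root:
  fixes A :: "real mat"
  assumes A: "A \<in> carrier_mat n n"
    and x: "\<And>i. i < n \<Longrightarrow> (\<Sum>j<n. A $$ (i, j) * x j) = r * x i"
    and y: "\<And>i. i < n \<Longrightarrow> (\<Sum>j<n. A $$ (i, j) * y j) = r * y i"
    and indep: "\<And>a b. (\<And>i. i < n \<Longrightarrow> a * x i + b * y i = 0) \<Longrightarrow> a = 0 \<and> b = 0"
  shows "2 \<le> order r (char_poly A)"
proof -
  let ?p = "char_poly A"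
  have "poly (char_poly (mat_delete A k k)) r = 0" if "k < n" for k
  proof -
    obtain a b where "a * x k + b * y k = 0" and ab: "a \<noteq> 0 \<or> b \<noteq> 0"
    proof (cases "x k = 0")
      case True
      then show ?thesis using that[of 1 0] by simp
    next
      case False
      then show ?thesis using that[of "y k" "- x k"] by simp
    qed
    define z where "z i = a * x i + b * y i" for i
    have zk: "z k = 0" using \<open>a * x k + b * y k = 0\<close> by (simp add: z_def)
    obtain m where m: "n = Suc m" using \<open>k < n\<close> by (cases n) auto
    have z: "(\<Sum>j<n. A $$ (i, j) * z j) = r * z i" if "i < n" for i
      using x[OF that] y[OF that] unfolding z_def
      by (simp add: distrib_left sum.distrib mult.left_commute[of _ a] mult.left_commute[of _ b]
          flip: sum_distrib_left)
    have img: "insert_index k ` {..<m} = {..<n} - {k}"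
      using insert_index_image[of k m] \<open>k < n\<close> by (simp add: m atLeast0LessThan)
    have "\<exists>i<n. z i \<noteq> 0" using indep[of a b] ab unfolding z_def by blast
    then obtain i where i: "i < n" "z i \<noteq> 0" by blast
    then have "i \<in> insert_index k ` {..<m}" unfolding img using zk by auto
    then have nonzero: "\<exists>i<m. z (insert_index k i) \<noteq> 0" using i by auto
    show ?thesis
    proof (rule char_poly_root_of_eigenvector[OF _ _ nonzero])
      show "mat_delete A k k \<in> carrier_mat m m" using mat_delete_carrier[OF A] by (simp add: m)
      fix i assume i: "i < m"
      have "(\<Sum>j<m. mat_delete A k k $$ (i, j) * z (insert_index k j)) =
          (\<Sum>j<m. A $$ (insert_index k i, insert_index k j) * z (insert_index k j))"
        using mat_delete_index[of A m k k i] A i \<open>k < n\<close> by (intro sum.cong) (auto simp: m)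
      also have "\<dots> = (\<Sum>j\<in>{..<n} - {k}. A $$ (insert_index k i, j) * z j)"
        unfolding img[symmetric] by (subst sum.reindex) (auto simp: insert_index_inj_on)
      also have "\<dots> = (\<Sum>j<n. A $$ (insert_index k i, j) * z j)"
        using zk by (intro sum.mono_neutral_left) auto
      also have "\<dots> = r * z (insert_index k i)"
        using i by (intro z) (auto simp: m insert_index_def)
      finally show "(\<Sum>j<m. mat_delete A k k $$ (i, j) * z (insert_index k j)) = r * z (insert_index k i)" .
    qed
  qed
  then have deriv: "poly (pderiv ?p) r = 0"
    by (simp add: pderiv_char_poly[OF A] poly_sum)
  have "\<exists>i<n. x i \<noteq> 0" using indep[of 1 0] by auto
  then have root: "poly ?p r = 0" by (intro char_poly_root_of_eigenvector[OF A x])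
  have p: "?p \<noteq> 0" using degree_monic_char_poly[OF A] by auto
  then have "order r ?p \<noteq> 0" using root by (simp add: order_root)
  moreover have p': "pderiv ?p \<noteq> 0"
  proof
    assume "pderiv ?p = 0"
    then have "degree ?p = 0" by (simp add: pderiv_eq_0_iff)
    then obtain c where "?p = [:c:]" by (rule degree_eq_zeroE)
    then show False using root p by simp
  qed
  moreover have "order r (pderiv ?p) \<noteq> 0" using deriv p' by (simp add: order_root)
  ultimately show ?thesis using order_pderiv[of ?p r] p root by simp
qed

lemma two_positive_eigenvalues:
  fixes A :: "real mat"
  assumes A: "A \<in> carrier_mat n n"
    and x: "\<And>i. i < n \<Longrightarrow> (\<Sum>j<n. A $$ (i, j) * x j) = r * x i" "0 < r"
    and y: "\<And>i. i < n \<Longrightarrow> (\<Sum>j<n. A $$ (i, j) * y j) = s * y i" "0 < s"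
    and indep: "\<And>a b. (\<And>i. i < n \<Longrightarrow> a * x i + b * y i = 0) \<Longrightarrow> a = 0 \<and> b = 0"
  shows "\<not> at_most_one_positive_eigenvalue A"
proof -
  let ?p = "char_poly A"
  define M where "M = filter_mset (\<lambda>t. 0 < t) (proots ?p)"
  have p: "?p \<noteq> 0" using degree_monic_char_poly[OF A] by auto
  have nz: "\<exists>i<n. x i \<noteq> 0" "\<exists>i<n. y i \<noteq> 0"
    using indep[of 1 0] indep[of 0 1] by auto
  have mem: "r \<in># M" "s \<in># M"
    unfolding M_def using p x(2) y(2) char_poly_root_of_eigenvector[OF A x(1) nz(1)]
      char_poly_root_of_eigenvector[OF A y(1) nz(2)] by auto
  have "{#r, s#} \<subseteq># M"
  proof (cases "r = s")
    case True
    then have "2 \<le> order r ?p" using char_poly_double_root[OF A, of x r y] x y indep by blast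
    then have "2 \<le> count M r" unfolding M_def using p x(2) by simp
    then show ?thesis using True by (simp add: subseteq_mset_def)
  next
    case False
    with mem show ?thesis by (simp add: insert_subset_eq_iff in_diff_count)
  qed
  then have "size {#r, s#} \<le> size M" by (rule size_mset_mono)
  then show ?thesis
    unfolding at_most_one_positive_eigenvalue_def by (simp add: M_def[symmetric])
qed

lemma unit_eigenvector:
  fixes h :: "'x \<Rightarrow> 'x \<Rightarrow> real"
  assumes "finite X" "\<And>i j. h i j = h j i"
    and w: "\<And>i. i \<in> X \<Longrightarrow> (\<Sum>j\<in>X. h i j * w j) = \<mu> * w i"
    and z: "(\<Sum>i\<in>X. w i * z i) = 0" "0 < bform X h z z"
  obtains v r where "0 < r" "\<exists>i\<in>X. v i \<noteq> 0" "(\<Sum>i\<in>X. w i * v i) = 0"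
    "\<And>i. i \<in> X \<Longrightarrow> (\<Sum>j\<in>X. h i j * v j) = r * v i"
proof (rule max_eigenvector[of X h "\<lambda>_. 1" w \<mu> z, OF assms(1,2)])
  fix v r
  assume "0 < r" "\<exists>i\<in>X. v i \<noteq> 0" "(\<Sum>i\<in>X. 1 * w i * v i) = 0"
    "\<And>i. i \<in> X \<Longrightarrow> (\<Sum>j\<in>X. h i j * v j) = r * 1 * v i"
  then show thesis by (intro that[of r v]) simp_all
qed (use w z in simp_all)

text \<open>Let \<open>v\<close> be an eigenvector of a positive eigenvalue. If the form were positive somewhere on the
  complement of \<open>v\<close>, there would be a second, orthogonal eigenvector there with a positive
  eigenvalue.\<close>
lemma hyperbolic_of_matrix:
  fixes h :: "'x \<Rightarrow> 'x \<Rightarrow> real"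
  assumes xs: "distinct xs" and sym: "\<And>i j. h i j = h j i"
    and eig: "at_most_one_positive_eigenvalue
      (mat (length xs) (length xs) (\<lambda>(i, j). h (xs ! i) (xs ! j)))"
  shows "hyperbolic (set xs) h"
proof (cases "\<exists>u. 0 < bform (set xs) h u u")
  case False
  then show ?thesis unfolding hyperbolic_def by blast
next
  case True
  then obtain u where u: "0 < bform (set xs) h u u" ..
  let ?X = "set xs" and ?n = "length xs"
  obtain v r where v: "0 < r" "\<exists>i\<in>?X. v i \<noteq> 0" "\<And>i. i \<in> ?X \<Longrightarrow> (\<Sum>j\<in>?X. h i j * v j) = r * v i"
  proof (rule unit_eigenvector[of ?X h "\<lambda>_. 0" 0 u, OF finite_set sym])
    show "0 < bform ?X h u u" by (rule u)
  qed (auto intro: that)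
  show ?thesis
  proof (rule hyperbolicI_hyperplane[where g = v, OF sym], rule ccontr)
    fix z assume "(\<Sum>i\<in>?X. v i * z i) = 0" and "\<not> bform ?X h z z \<le> 0"
    then have z: "(\<Sum>i\<in>?X. v i * z i) = 0" "0 < bform ?X h z z" by linarith+
    obtain v' r' where v': "0 < r'" "\<exists>i\<in>?X. v' i \<noteq> 0" "(\<Sum>i\<in>?X. v i * v' i) = 0"
      "\<And>i. i \<in> ?X \<Longrightarrow> (\<Sum>j\<in>?X. h i j * v' j) = r' * v' i"
      by (rule unit_eigenvector[OF finite_set sym v(3) z]) (simp, blast)
    have nth: "(\<Sum>j<?n. f (xs ! j)) = (\<Sum>x\<in>?X. f x)" for f :: "'x \<Rightarrow> real"
      using sum.reindex_bij_betw[OF bij_betw_nth[OF xs refl refl], of f] by simp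
    have "\<not> at_most_one_positive_eigenvalue (mat ?n ?n (\<lambda>(i, j). h (xs ! i) (xs ! j)))"
    proof (rule two_positive_eigenvalues[where n = ?n and x = "\<lambda>i. v (xs ! i)" and y = "\<lambda>i. v' (xs ! i)"])
      show "(\<Sum>j<?n. mat ?n ?n (\<lambda>(i, j). h (xs ! i) (xs ! j)) $$ (i, j) * v (xs ! j)) = r * v (xs ! i)"
        if "i < ?n" for i
        using that v(3)[of "xs ! i"] nth[of "\<lambda>x. h (xs ! i) x * v x"] by simp
      show "(\<Sum>j<?n. mat ?n ?n (\<lambda>(i, j). h (xs ! i) (xs ! j)) $$ (i, j) * v' (xs ! j)) = r' * v' (xs ! i)"
        if "i < ?n" for i
        using that v'(4)[of "xs ! i"] nth[of "\<lambda>x. h (xs ! i) x * v' x"] by simp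
      fix a b
      assume "\<And>i. i < ?n \<Longrightarrow> a * v (xs ! i) + b * v' (xs ! i) = 0"
      then have ab: "a * v x + b * v' x = 0" if "x \<in> ?X" for x
        using that by (metis in_set_conv_nth)
      have pos: "0 < (\<Sum>x\<in>?X. f x * f x)" if "\<exists>x\<in>?X. f x \<noteq> 0" for f :: "'x \<Rightarrow> real"
        using that by (auto intro!: sum_pos2 simp: zero_less_mult_iff)
      have "0 = (\<Sum>x\<in>?X. v x * (a * v x + b * v' x))" using ab by simp
      also have "\<dots> = a * (\<Sum>x\<in>?X. v x * v x) + b * (\<Sum>x\<in>?X. v x * v' x)"
        by (simp add: algebra_simps sum.distrib sum_distrib_left)
      finally have "a = 0" using v'(3) pos[OF v(2)] by simp
      with ab v'(2) show "a = 0 \<and> b = 0" by auto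
    qed (use v v' in auto)
    with eig show False by contradiction
  qed
qed

section \<open>The spectral gap argument\<close>

text \<open>The family \<open>t\<close> plays the part of the third derivatives of a polynomial in \<open>l\<close>, \<open>i\<close>, \<open>j\<close>,
  and \<open>h\<close> that of the Hessian of its derivative in direction \<open>w\<close>. The last assumption is
  irreducibility of \<open>h\<close> after its zero rows have been removed, stated through cuts \<open>S\<close>.\<close>
lemma trickle_down:
  fixes t :: "'x \<Rightarrow> 'x \<Rightarrow> 'x \<Rightarrow> real"
  assumes fin: "finite X" and w: "\<And>i. i \<in> X \<Longrightarrow> 0 < w i"
    and nonneg: "\<And>l i j. l \<in> X \<Longrightarrow> i \<in> X \<Longrightarrow> j \<in> X \<Longrightarrow> 0 \<le> t l i j"
    and sym: "\<And>l i j. t l i j = t l j i" "\<And>l i j. t l i j = t i l j"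
    and hyp: "\<And>l. l \<in> X \<Longrightarrow> hyperbolic X (t l)"
    and h: "\<And>i j. h i j = (\<Sum>l\<in>X. w l * t l i j)"
    and connected: "\<And>S i j a b. S \<subseteq> X \<Longrightarrow> i \<in> S \<Longrightarrow> j \<in> X - S \<Longrightarrow> a \<in> X \<Longrightarrow> b \<in> X \<Longrightarrow>
       0 < h i a \<Longrightarrow> 0 < h j b \<Longrightarrow> \<exists>i'\<in>S. \<exists>j'\<in>X - S. 0 < h i' j'"
  shows "hyperbolic X h"
proof -
  have h_sym: "h i j = h j i" for i j unfolding h using sym(1) by simp
  have h_nonneg: "0 \<le> h i j" if "i \<in> X" "j \<in> X" for i j
    unfolding h using that w nonneg by (intro sum_nonneg mult_nonneg_nonneg) (auto simp: less_imp_le)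
  define r where "r i = (\<Sum>j\<in>X. h i j * w j)" for i
  have r_nonneg: "0 \<le> r i" if "i \<in> X" for i
    unfolding r_def using that w h_nonneg by (intro sum_nonneg mult_nonneg_nonneg) (auto simp: less_imp_le)
  have t_row: "(\<Sum>j\<in>X. t l i j * w j) = h l i" for l i
  proof -
    have "t l i j = t j l i" for j using sym(1)[of l i j] sym(2)[of l j i] by simp
    then show ?thesis unfolding h by (simp add: mult.commute)
  qed
  have t_form_w: "bform X (t l) w v = (\<Sum>j\<in>X. h l j * v j)" for l v
  proof -
    have "bform X (t l) w v = bform X (t l) v w" by (rule bform_commute[OF sym(1)])
    then show ?thesis unfolding bform_eq_row t_row by (simp add: mult.commute)
  qed
  have t_form_ww: "bform X (t l) w w = r l" for l
    unfolding t_form_w r_def ..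
  \<comment> \<open>Only the nonzero rows admit a positive weight; the other rows contribute nothing.\<close>
  define Y where "Y = {i \<in> X. 0 < r i}"
  have finY: "finite Y" and YX: "Y \<subseteq> X" using fin by (auto simp: Y_def)
  have h_zero: "h i j = 0" if "i \<in> X - Y" "j \<in> X" for i j
  proof -
    have "r i = 0" using that r_nonneg[of i] by (auto simp: Y_def)
    then have "h i j * w j = 0"
      unfolding r_def using that fin h_nonneg w
      by (subst (asm) sum_nonneg_eq_0_iff) (auto simp: less_imp_le)
    then show ?thesis using w[OF that(2)] by simp
  qed
  have hY: "i \<in> Y" if "i \<in> X" "j \<in> X" "0 < h i j" for i j
    using h_zero[of i j] that by (cases "i \<in> Y") auto
  have t_zero: "t l i j = 0" if "l \<in> X - Y" "i \<in> X" "j \<in> X" for l i j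
  proof -
    have "(\<Sum>j\<in>X. t l i j * w j) = 0" unfolding t_row using h_zero that by simp
    then have "t l i j * w j = 0"
      using that fin nonneg w by (subst (asm) sum_nonneg_eq_0_iff) (auto simp: less_imp_le)
    then show ?thesis using w[OF that(3)] by simp
  qed
  have sum_Y: "(\<Sum>j\<in>X. h i j * v j) = (\<Sum>j\<in>Y. h i j * v j)" if "i \<in> X" for i v
  proof (intro sum.mono_neutral_right fin YX ballI)
    show "h i j * v j = 0" if "j \<in> X - Y" for j
      using h_zero[OF that \<open>i \<in> X\<close>] h_sym[of i j] by simp
  qed
  define D where "D i = r i / w i" for i
  have D_pos: "0 < D i" if "i \<in> Y" for i
    using that w YX unfolding D_def Y_def by auto
  have Dw: "D i * w i = r i" if "i \<in> X" for i using w[OF that] by (simp add: D_def)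
  \<comment> \<open>The reversed Cauchy-Schwarz inequality for \<open>t l\<close> against \<open>w\<close> bounds
    \<open>bform X (t l) v v\<close> by the square of row \<open>l\<close> of \<open>h\<close> at \<open>v\<close>, divided by \<open>r l\<close>.\<close>
  have key: "bform X h v v \<le> (\<Sum>l\<in>Y. (\<Sum>j\<in>Y. h l j * v j)\<^sup>2 / D l)" for v
  proof -
    have "bform X h v v = (\<Sum>l\<in>X. w l * bform X (t l) v v)"
    proof -
      have "bform X h v v = (\<Sum>i\<in>X. \<Sum>j\<in>X. \<Sum>l\<in>X. w l * (v i * v j * t l i j))"
        unfolding bform_def h by (simp add: sum_distrib_left mult_ac)
      also have "\<dots> = (\<Sum>i\<in>X. \<Sum>l\<in>X. \<Sum>j\<in>X. w l * (v i * v j * t l i j))"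
        by (intro sum.cong refl sum.swap)
      also have "\<dots> = (\<Sum>l\<in>X. \<Sum>i\<in>X. \<Sum>j\<in>X. w l * (v i * v j * t l i j))"
        by (rule sum.swap)
      also have "\<dots> = (\<Sum>l\<in>X. w l * bform X (t l) v v)"
        unfolding bform_def by (simp add: sum_distrib_left)
      finally show ?thesis .
    qed
    also have "\<dots> = (\<Sum>l\<in>Y. w l * bform X (t l) v v)"
      using fin YX t_zero by (intro sum.mono_neutral_right) (auto simp: bform_def)
    also have "\<dots> \<le> (\<Sum>l\<in>Y. (\<Sum>j\<in>Y. h l j * v j)\<^sup>2 / D l)"
    proof (rule sum_mono)
      fix l assume l: "l \<in> Y"
      then have lX: "l \<in> X" and rl: "0 < r l" using YX by (auto simp: Y_def)
      have "r l * bform X (t l) v v \<le> (\<Sum>j\<in>Y. h l j * v j)\<^sup>2"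
        using hyp[OF lX, unfolded hyperbolic_def, rule_format, of w v] rl
        unfolding t_form_ww unfolding t_form_w sum_Y[OF lX] by simp
      then have "w l * (r l * bform X (t l) v v) \<le> w l * (\<Sum>j\<in>Y. h l j * v j)\<^sup>2"
        using w[OF lX] by (intro mult_left_mono) auto
      then show "w l * bform X (t l) v v \<le> (\<Sum>j\<in>Y. h l j * v j)\<^sup>2 / D l"
        using rl w[OF lX] by (simp add: D_def field_simps)
    qed
    finally show ?thesis .
  qed
  have form_Y: "bform X h v v = bform Y h v v" for v
  proof -
    have "bform X h v v = (\<Sum>i\<in>X. v i * (\<Sum>j\<in>Y. h i j * v j))"
      unfolding bform_eq_row using sum_Y by simp
    also have "\<dots> = bform Y h v v"
      unfolding bform_eq_row using fin YX h_zero by (intro sum.mono_neutral_right) (auto simp: subset_iff)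
    finally show ?thesis .
  qed
  show ?thesis
  proof (rule hyperbolicI_hyperplane[where g = r, OF h_sym], rule ccontr)
    fix z assume z: "(\<Sum>i\<in>X. r i * z i) = 0" "\<not> bform X h z z \<le> 0"
    have "(\<Sum>i\<in>Y. D i * w i * z i) = (\<Sum>i\<in>Y. r i * z i)"
      using YX Dw by (intro sum.cong) auto
    also have "\<dots> = (\<Sum>i\<in>X. r i * z i)"
      using fin YX r_nonneg by (intro sum.mono_neutral_left) (force simp: Y_def)+
    finally have zY: "(\<Sum>i\<in>Y. D i * w i * z i) = 0" using z(1) by simp
    have wY: "(\<Sum>j\<in>Y. h i j * w j) = 1 * D i * w i" if "i \<in> Y" for i
      using that YX sum_Y[of i w] Dw[of i] by (auto simp: r_def)
    obtain v s where s: "0 < s" and nz: "\<exists>i\<in>Y. v i \<noteq> 0" and vw: "(\<Sum>i\<in>Y. D i * w i * v i) = 0"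
      and ev: "\<And>i. i \<in> Y \<Longrightarrow> (\<Sum>j\<in>Y. h i j * v j) = s * D i * v i"
    proof (rule max_eigenvector[OF finY h_sym D_pos wY zY])
      show "0 < bform Y h z z" using z(2) form_Y[of z] by simp
    qed blast+
    define N where "N = (\<Sum>i\<in>Y. D i * (v i)\<^sup>2)"
    have "0 < N"
      unfolding N_def using nz finY D_pos by (auto intro!: sum_pos2 simp: less_imp_le)
    have Q: "bform X h v v = s * N"
      unfolding form_Y unfolding bform_eq_row N_def by (simp add: ev) (simp add: sum_distrib_left power2_eq_square mult_ac)
    have "(\<Sum>l\<in>Y. (\<Sum>j\<in>Y. h l j * v j)\<^sup>2 / D l) = s\<^sup>2 * N"
      unfolding N_def sum_distrib_left
    proof (intro sum.cong refl)
      fix l assume "l \<in> Y"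
      then show "(\<Sum>j\<in>Y. h l j * v j)\<^sup>2 / D l = s\<^sup>2 * (D l * (v l)\<^sup>2)"
        using D_pos[of l] by (simp add: ev power2_eq_square)
    qed
    then have "s * N \<le> s\<^sup>2 * N" using key[of v] Q by simp
    then have "1 \<le> s" using \<open>0 < N\<close> s by (simp add: power2_eq_square)
    \<comment> \<open>The difference of \<open>D\<close> and \<open>h\<close> is a Dirichlet form in the ratios \<open>v i / w i\<close>. It is
      non-negative, and at \<open>v\<close> it equals \<open>(1 - s) N \<le> 0\<close>, so it vanishes and the ratios agree along
      all positive entries of \<open>h\<close>.\<close>
    define e where "e i j = h i j * w i * w j * (v i / w i - v j / w j)\<^sup>2" for i j
    have e_nonneg: "0 \<le> e i j" if "i \<in> Y" "j \<in> Y" for i j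
      unfolding e_def using that YX h_nonneg w by (auto intro!: mult_nonneg_nonneg simp: less_imp_le subset_iff)
    have "(\<Sum>i\<in>Y. \<Sum>j\<in>Y. e i j) = 2 * N - 2 * bform Y h v v"
    proof -
      let ?f = "\<lambda>i j. (v i)\<^sup>2 / w i * (h i j * w j)"
      have e_eq: "e i j = ?f i j + ?f j i - 2 * (v i * v j * h i j)" if "i \<in> Y" "j \<in> Y" for i j
      proof -
        have "0 < w i" "0 < w j" using that YX w by auto
        then show ?thesis unfolding e_def
          by (simp add: power2_eq_square field_simps h_sym[of j i])
      qed
      have row: "(\<Sum>i\<in>Y. \<Sum>j\<in>Y. ?f i j) = N"
        unfolding sum_distrib_left[symmetric] N_def
      proof (intro sum.cong refl)
        fix i assume i: "i \<in> Y"
        have "0 < w i" using i YX w by auto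
        then show "(v i)\<^sup>2 / w i * (\<Sum>j\<in>Y. h i j * w j) = D i * (v i)\<^sup>2"
          unfolding wY[OF i] by simp
      qed
      have "(\<Sum>i\<in>Y. \<Sum>j\<in>Y. e i j) =
          (\<Sum>i\<in>Y. \<Sum>j\<in>Y. ?f i j) + (\<Sum>i\<in>Y. \<Sum>j\<in>Y. ?f j i) - 2 * bform Y h v v"
        by (simp add: e_eq sum.distrib sum_subtractf bform_def sum_distrib_left)
      also have "(\<Sum>i\<in>Y. \<Sum>j\<in>Y. ?f j i) = (\<Sum>i\<in>Y. \<Sum>j\<in>Y. ?f i j)" by (rule sum.swap)
      finally show ?thesis unfolding row by simp
    qed
    also have "\<dots> = 2 * N * (1 - s)" using Q form_Y[of v] by (simp add: algebra_simps)
    also have "\<dots> \<le> 0" using \<open>0 < N\<close> \<open>1 \<le> s\<close> by (simp add: mult_le_0_iff)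
    finally have "(\<Sum>i\<in>Y. \<Sum>j\<in>Y. e i j) = 0"
      using e_nonneg by (meson order_antisym sum_nonneg)
    then have e_zero: "e i j = 0" if "i \<in> Y" "j \<in> Y" for i j
      using that finY e_nonneg by (simp add: sum_nonneg_eq_0_iff sum_nonneg)
    have ratio: "v i / w i = v j / w j" if "i \<in> Y" "j \<in> Y" "0 < h i j" for i j
    proof -
      have "0 < w i" "0 < w j" using that YX w by auto
      then show ?thesis using e_zero[OF that(1,2)] that(3) unfolding e_def by simp
    qed
    obtain i where i: "i \<in> Y" "v i \<noteq> 0" using nz by blast
    \<comment> \<open>By irreducibility \<open>v\<close> is a multiple of \<open>w\<close> on \<open>Y\<close>, which contradicts orthogonality.\<close>
    define S where "S = {j \<in> Y. v j / w j = v i / w i}"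
    have "S = Y"
    proof (rule ccontr)
      assume "S \<noteq> Y"
      then obtain j where j: "j \<in> Y" "j \<notin> S" by (auto simp: S_def)
      have ex: "\<exists>a\<in>X. 0 < h k a" if "k \<in> Y" for k
      proof (rule ccontr)
        assume "\<not> ?thesis"
        then have "r k \<le> 0"
          unfolding r_def using w by (intro sum_nonpos) (auto simp: mult_le_0_iff not_less less_imp_le)
        with that show False by (simp add: Y_def)
      qed
      obtain a b where "a \<in> X" "0 < h i a" "b \<in> X" "0 < h j b" using ex[OF i(1)] ex[OF j(1)] by blast
      moreover have "S \<subseteq> X" "i \<in> S" "j \<in> X - S" using i j YX by (auto simp: S_def)
      ultimately obtain i' j' where ij: "i' \<in> S" "j' \<in> X - S" "0 < h i' j'"
        using connected by blast
      then have "i' \<in> Y" "j' \<in> Y" using hY[of j' i'] h_sym[of i' j'] YX by (auto simp: S_def)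
      then show False using ratio[of i' j'] ij by (auto simp: S_def)
    qed
    have "v j = v i / w i * w j" if "j \<in> Y" for j
    proof -
      have "v j / w j = v i / w i" using \<open>S = Y\<close> that by (auto simp: S_def)
      moreover have "0 < w j" using that w YX by auto
      ultimately show ?thesis by (simp add: divide_eq_eq)
    qed
    then have "(\<Sum>j\<in>Y. D j * w j * v j) = (\<Sum>j\<in>Y. v i / w i * (D j * (w j * w j)))"
      by (intro sum.cong refl) (metis mult.assoc mult.left_commute)
    then have "v i / w i * (\<Sum>j\<in>Y. D j * (w j * w j)) = 0"
      using vw by (simp add: sum_distrib_left)
    moreover have "0 < (\<Sum>j\<in>Y. D j * (w j * w j))"
      using i(1) finY YX D_pos w by (intro sum_pos) (auto simp: subset_iff)
    moreover have "w i \<noteq> 0" using i(1) YX w[of i] by auto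
    ultimately show False using i(2) by simp
  qed
qed

section \<open>Partial derivatives and M-convex supports\<close>

abbreviation e1 :: "'x \<Rightarrow> 'x mon" where
  "e1 x \<equiv> Poly_Mapping.single x 1"

lemma lookup_partial_derivative:
  "Poly_Mapping.lookup (partial_derivative l p) m =
     real (Poly_Mapping.lookup m l + 1) * Poly_Mapping.lookup p (m + e1 l)"
proof -
  have "Poly_Mapping.lookup (partial_derivative l p) m =
      (\<Sum>n\<in>Poly_Mapping.keys p. if n = m + e1 l then real (Poly_Mapping.lookup n l) * Poly_Mapping.lookup p n else 0)"
    unfolding partial_derivative_def lookup_sum
  proof (intro sum.cong refl)
    fix n
    show "Poly_Mapping.lookup (Poly_Mapping.single (n - e1 l) (real (Poly_Mapping.lookup n l) * Poly_Mapping.lookup p n)) m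
      = (if n = m + e1 l then real (Poly_Mapping.lookup n l) * Poly_Mapping.lookup p n else 0)"
    proof (cases "Poly_Mapping.lookup n l = 0")
      case True
      then have "n \<noteq> m + e1 l" by (auto simp: lookup_add)
      then show ?thesis using True by simp
    next
      case False
      then have "n - e1 l + e1 l = n"
        by (intro poly_mapping_eqI) (auto simp: lookup_add lookup_minus lookup_single when_def)
      then have "n - e1 l = m \<longleftrightarrow> n = m + e1 l" by auto
      then show ?thesis by (simp add: lookup_single when_def)
    qed
  qed
  also have "\<dots> = real (Poly_Mapping.lookup m l + 1) * Poly_Mapping.lookup p (m + e1 l)"
    by (simp add: lookup_add in_keys_iff)
  finally show ?thesis .
qed

lemma partial_derivative_commute:
  "partial_derivative i (partial_derivative j p) = partial_derivative j (partial_derivative i p)"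
proof (cases "i = j")
  case False
  show ?thesis
    by (rule poly_mapping_eqI)
      (use False in \<open>simp add: lookup_partial_derivative lookup_add lookup_single add_ac\<close>)
qed simp

lemma keys_partial_derivative:
  "m \<in> Poly_Mapping.keys (partial_derivative l p) \<longleftrightarrow> m + e1 l \<in> Poly_Mapping.keys p"
  by (simp add: in_keys_iff lookup_partial_derivative)

lemma monomial_minus_e1:
  assumes "0 < Poly_Mapping.lookup m l"
  shows "m - e1 l + e1 l = m"
  by (rule poly_mapping_eqI) (use assms in \<open>auto simp: lookup_add lookup_minus lookup_single when_def\<close>)

text \<open>The Lorentzian condition with eigenvalues replaced by the reversed Cauchy-Schwarz inequality and
  with the degree as a parameter, so that it passes to partial derivatives.\<close>
definition hereditarily_hyperbolic :: "'x set \<Rightarrow> nat \<Rightarrow> 'x polynomial \<Rightarrow> bool" where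
  "hereditarily_hyperbolic X d p \<longleftrightarrow>
     (\<forall>m\<in>Poly_Mapping.keys p. Poly_Mapping.keys m \<subseteq> X) \<and> homogeneous d p \<and>
     (\<forall>m. 0 \<le> Poly_Mapping.lookup p m) \<and> M_convex (Poly_Mapping.keys p) \<and>
     (\<forall>zs. set zs \<subseteq> X \<and> length zs + 2 = d \<longrightarrow>
        hyperbolic X (\<lambda>i j. Poly_Mapping.lookup
          (partial_derivative i (partial_derivative j (fold partial_derivative zs p))) 0))"

lemma hereditarily_hyperbolic_if_lorentzian:
  assumes "lorentzian X p"
  obtains d where "finite X" "hereditarily_hyperbolic X d p"
proof -
  obtain d xs where xs: "distinct xs" "set xs = X"
    and p: "\<forall>m\<in>Poly_Mapping.keys p. Poly_Mapping.keys m \<subseteq> X" "homogeneous d p"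
      "\<forall>m. 0 \<le> Poly_Mapping.lookup p m" "M_convex (Poly_Mapping.keys p)"
      "\<And>zs. set zs \<subseteq> X \<and> length zs + 2 = d \<Longrightarrow>
         at_most_one_positive_eigenvalue (hessian xs (fold partial_derivative zs p))"
    using assms unfolding lorentzian_def by blast
  have "hyperbolic X (\<lambda>i j. Poly_Mapping.lookup
      (partial_derivative i (partial_derivative j (fold partial_derivative zs p))) 0)"
    if "set zs \<subseteq> X \<and> length zs + 2 = d" for zs
    unfolding xs(2)[symmetric]
    by (rule hyperbolic_of_matrix[OF xs(1) _ p(5)[OF that, unfolded hessian_def]])
      (simp add: partial_derivative_commute)
  then have "hereditarily_hyperbolic X d p"
    unfolding hereditarily_hyperbolic_def using p by blast
  moreover have "finite X" using xs(2) by (metis finite_set)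
  ultimately show thesis using that by blast
qed

text \<open>The support of \<open>\<partial>\<^sub>l p\<close> is the part of the support of \<open>p\<close> where the exponent of \<open>l\<close> is positive,
  shifted down by one. An exchange never leaves this part: if it lowers the exponent of \<open>l\<close>,
  then that exponent exceeded another positive one.\<close>
lemma M_convex_partial_derivative:
  assumes "M_convex (Poly_Mapping.keys p)"
  shows "M_convex (Poly_Mapping.keys (partial_derivative l p))"
  unfolding M_convex_def
proof (intro conjI ballI allI impI)
  fix \<alpha> \<beta> i
  assume \<alpha>: "\<alpha> \<in> Poly_Mapping.keys (partial_derivative l p)"
    and \<beta>: "\<beta> \<in> Poly_Mapping.keys (partial_derivative l p)"
    and i: "Poly_Mapping.lookup \<beta> i < Poly_Mapping.lookup \<alpha> i"
  have "Poly_Mapping.lookup (\<beta> + e1 l) i < Poly_Mapping.lookup (\<alpha> + e1 l) i"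
    using i by (simp add: lookup_add)
  then obtain j where j: "Poly_Mapping.lookup (\<alpha> + e1 l) j < Poly_Mapping.lookup (\<beta> + e1 l) j"
    "\<alpha> + e1 l - e1 i + e1 j \<in> Poly_Mapping.keys p"
    using assms \<alpha> \<beta> unfolding M_convex_def keys_partial_derivative by blast
  have "\<alpha> + e1 l - e1 i + e1 j = \<alpha> - e1 i + e1 j + e1 l"
    by (rule poly_mapping_eqI)
      (use i in \<open>auto simp: lookup_add lookup_minus lookup_single when_def\<close>)
  with j show "\<exists>j. Poly_Mapping.lookup \<alpha> j < Poly_Mapping.lookup \<beta> j \<and>
      \<alpha> - e1 i + e1 j \<in> Poly_Mapping.keys (partial_derivative l p)"
    unfolding keys_partial_derivative by (auto simp: lookup_add)
qed simp

lemma homogeneous_partial_derivative: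
  assumes "homogeneous (Suc d) p"
  shows "homogeneous d (partial_derivative l p)"
  using assms unfolding homogeneous_def
  by (auto simp: keys_partial_derivative mon_degree_add dest!: bspec)

lemma keys_subset_partial_derivative:
  assumes "\<forall>m\<in>Poly_Mapping.keys p. Poly_Mapping.keys m \<subseteq> X"
  shows "\<forall>m\<in>Poly_Mapping.keys (partial_derivative l p). Poly_Mapping.keys m \<subseteq> X"
proof
  fix m assume "m \<in> Poly_Mapping.keys (partial_derivative l p)"
  then have "Poly_Mapping.keys (m + e1 l) \<subseteq> X" using assms by (simp add: keys_partial_derivative)
  then show "Poly_Mapping.keys m \<subseteq> X"
    by (auto simp: in_keys_iff lookup_add subset_iff)
qed

lemma nonneg_partial_derivative:
  assumes "\<forall>m. 0 \<le> Poly_Mapping.lookup p m"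
  shows "\<forall>m. 0 \<le> Poly_Mapping.lookup (partial_derivative l p) m"
  using assms by (simp add: lookup_partial_derivative)

lemma hereditarily_hyperbolic_partial_derivative:
  assumes p: "hereditarily_hyperbolic X (Suc d) p" and l: "l \<in> X"
  shows "hereditarily_hyperbolic X d (partial_derivative l p)"
proof -
  have "hyperbolic X (\<lambda>i j. Poly_Mapping.lookup
      (partial_derivative i (partial_derivative j (fold partial_derivative zs (partial_derivative l p)))) 0)"
    if "set zs \<subseteq> X \<and> length zs + 2 = d" for zs
  proof -
    have "set (l # zs) \<subseteq> X \<and> length (l # zs) + 2 = Suc d" using that l by simp
    then have "hyperbolic X (\<lambda>i j. Poly_Mapping.lookup
      (partial_derivative i (partial_derivative j (fold partial_derivative (l # zs) p))) 0)"
      using p unfolding hereditarily_hyperbolic_def by blast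
    then show ?thesis by simp
  qed
  then show ?thesis
    using p keys_subset_partial_derivative[of p X l] homogeneous_partial_derivative[of d p l]
      nonneg_partial_derivative[of p l] M_convex_partial_derivative[of p l]
    unfolding hereditarily_hyperbolic_def by simp
qed

section \<open>Derivatives in several directions\<close>

text \<open>The constant coefficient of the iterated derivative of \<open>p\<close> in the directions \<open>ws\<close>. For \<open>p\<close>
  homogeneous of degree \<open>length ws\<close> this is the value of the iterated derivative, that is, up to
  normalisation, the polarisation of \<open>p\<close>.\<close>
fun directional :: "'x set \<Rightarrow> ('x \<Rightarrow> real) list \<Rightarrow> 'x polynomial \<Rightarrow> real" where
  "directional X [] p = Poly_Mapping.lookup p 0"
| "directional X (w # ws) p = (\<Sum>l\<in>X. w l * directional X ws (partial_derivative l p))"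

lemma directional_nonneg:
  assumes "\<And>w i. w \<in> set ws \<Longrightarrow> i \<in> X \<Longrightarrow> 0 < w i" and "\<forall>m. 0 \<le> Poly_Mapping.lookup p m"
  shows "0 \<le> directional X ws p"
  using assms
proof (induction ws arbitrary: p)
  case (Cons w ws)
  then show ?case
    by (auto intro!: sum_nonneg mult_nonneg_nonneg simp: less_imp_le nonneg_partial_derivative)
qed simp

lemma directional_pos:
  assumes "finite X" "\<And>w i. w \<in> set ws \<Longrightarrow> i \<in> X \<Longrightarrow> 0 < w i" "\<forall>m. 0 \<le> Poly_Mapping.lookup p m"
    and "homogeneous (length ws) p" "\<forall>m\<in>Poly_Mapping.keys p. Poly_Mapping.keys m \<subseteq> X"
    and "m \<in> Poly_Mapping.keys p"
  shows "0 < directional X ws p"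
  using assms
proof (induction ws arbitrary: p m)
  case Nil
  then have "mon_degree m = 0" by (simp add: homogeneous_def)
  then have "m = 0" by (intro poly_mapping_eqI) (auto simp: mon_degree_def in_keys_iff)
  with Nil show ?case by (simp add: in_keys_iff less_le)
next
  case (Cons w ws)
  have "mon_degree m = Suc (length ws)" using Cons.prems by (simp add: homogeneous_def)
  then obtain l where l: "l \<in> Poly_Mapping.keys m"
    unfolding mon_degree_def by fastforce
  then have "l \<in> X" using Cons.prems by blast
  have m_pos: "0 < Poly_Mapping.lookup m l" using l by (simp add: in_keys_iff)
  have "m - e1 l \<in> Poly_Mapping.keys (partial_derivative l p)"
    unfolding keys_partial_derivative monomial_minus_e1[OF m_pos] using Cons.prems by simp
  then have "0 < directional X ws (partial_derivative l p)"
    using Cons.prems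
    by (intro Cons.IH) (simp_all add: nonneg_partial_derivative homogeneous_partial_derivative
        keys_subset_partial_derivative)
  then have "0 < w l * directional X ws (partial_derivative l p)"
    using Cons.prems \<open>l \<in> X\<close> by simp
  moreover have "0 \<le> w i * directional X ws (partial_derivative i p)" if "i \<in> X" for i
    using Cons.prems that
    by (intro mult_nonneg_nonneg directional_nonneg) (auto simp: nonneg_partial_derivative less_imp_le)
  ultimately show ?case
    using Cons.prems(1) \<open>l \<in> X\<close> by (auto intro: sum_pos2)
qed

lemma directional_zero [simp]: "directional X ws 0 = 0"
proof (induction ws)
  case (Cons w ws)
  have "partial_derivative l 0 = (0 :: 'a polynomial)" for l
    by (simp add: partial_derivative_def)
  with Cons show ?case by simp
qed simp

lemma directional_form:
  "directional X (u # v # ws) p =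
     bform X (\<lambda>i j. directional X ws (partial_derivative i (partial_derivative j p))) u v"
  by (simp add: bform_def sum_distrib_left mult_ac partial_derivative_commute)

text \<open>If the variables in \<open>S\<close> and those outside \<open>S\<close> never met in a monomial, then exchanging one unit of
  a monomial over \<open>S\<close> for a variable of a monomial outside \<open>S\<close> would produce a mixed
  monomial, because degree at least 2 leaves another unit in \<open>S\<close>.\<close>
lemma M_convex_mixed_monomial:
  assumes M: "M_convex A" and d: "\<And>m. m \<in> A \<Longrightarrow> 2 \<le> mon_degree m \<and> Poly_Mapping.keys m \<subseteq> X"
    and \<alpha>: "\<alpha> \<in> A" "0 < Poly_Mapping.lookup \<alpha> i" "i \<in> S"
    and \<beta>: "\<beta> \<in> A" "0 < Poly_Mapping.lookup \<beta> j" "j \<in> X - S"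
  obtains m i' j' where "m \<in> A" "i' \<in> S" "j' \<in> X - S"
    "0 < Poly_Mapping.lookup m i'" "0 < Poly_Mapping.lookup m j'"
proof (cases "Poly_Mapping.lookup \<beta> i = 0 \<and> (\<forall>k. 0 < Poly_Mapping.lookup \<alpha> k \<longrightarrow> k \<in> S)")
  case False
  show ?thesis
  proof (cases "Poly_Mapping.lookup \<beta> i = 0")
    case True
    then obtain k where "0 < Poly_Mapping.lookup \<alpha> k" "k \<notin> S" using False by blast
    moreover have "k \<in> X" using d[OF \<alpha>(1)] \<open>0 < Poly_Mapping.lookup \<alpha> k\<close> by (auto simp: in_keys_iff)
    ultimately show ?thesis using that[of \<alpha> i k] \<alpha> by blast
  next
    case False
    then show ?thesis using that[of \<beta> i j] \<alpha> \<beta> by simp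
  qed
next
  case True
  then have "Poly_Mapping.lookup \<beta> i < Poly_Mapping.lookup \<alpha> i" using \<alpha>(2) by simp
  then obtain k where k: "Poly_Mapping.lookup \<alpha> k < Poly_Mapping.lookup \<beta> k" "\<alpha> - e1 i + e1 k \<in> A"
    using M[unfolded M_convex_def, THEN conjunct2, rule_format, OF \<alpha>(1) \<beta>(1)] by blast
  let ?\<gamma> = "\<alpha> - e1 i + e1 k"
  have "mon_degree (\<alpha> - e1 i) + 1 = mon_degree \<alpha>"
    using arg_cong[OF monomial_minus_e1[OF \<alpha>(2)], of mon_degree] by (simp add: mon_degree_add)
  then have "mon_degree (\<alpha> - e1 i) \<noteq> 0" using d[OF \<alpha>(1)] by simp
  then obtain a where a: "a \<in> Poly_Mapping.keys (\<alpha> - e1 i)"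
    unfolding mon_degree_def by fastforce
  then have "0 < Poly_Mapping.lookup \<alpha> a" by (simp add: in_keys_iff lookup_minus)
  then have "a \<in> S" using True by blast
  have \<gamma>: "0 < Poly_Mapping.lookup ?\<gamma> a" "0 < Poly_Mapping.lookup ?\<gamma> k"
    using a by (simp_all add: in_keys_iff lookup_add)
  have kX: "k \<in> X" using d[OF \<beta>(1)] k(1) by (auto simp: in_keys_iff)
  show ?thesis
  proof (cases "k \<in> S")
    case False
    then show ?thesis using that[OF k(2) \<open>a \<in> S\<close> _ \<gamma>] kX by blast
  next
    case True
    then have "0 < Poly_Mapping.lookup \<beta> k" using k by simp
    then show ?thesis using that[of \<beta> k j] \<beta> True by blast
  qed
qed

text \<open>Induction on the directions: for the first direction \<open>w\<close>, the forms of the polynomials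
  \<open>\<partial>\<^sub>l p\<close> in the remaining directions are hyperbolic, and \<open>trickle_down\<close> combines them.
  The symmetry of mixed derivatives is what relates the form of \<open>\<partial>\<^sub>l p\<close> at \<open>w\<close> to row \<open>l\<close> of the form
  of \<open>\<partial>\<^sub>w p\<close>.\<close>
lemma hyperbolic_directional:
  assumes "finite X" "hereditarily_hyperbolic X (length ws + 2) p"
    and "\<And>w i. w \<in> set ws \<Longrightarrow> i \<in> X \<Longrightarrow> 0 < w i"
  shows "hyperbolic X (\<lambda>i j. directional X ws (partial_derivative i (partial_derivative j p)))"
  using assms(2,3)
proof (induction ws arbitrary: p)
  case Nil
  have "set [] \<subseteq> X \<and> length [] + 2 = length [] + 2" by simp
  then show ?case
    using Nil.prems(1) unfolding hereditarily_hyperbolic_def by fastforce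
next
  case (Cons w ws)
  let ?D = partial_derivative
  let ?h = "\<lambda>i j. directional X (w # ws) (?D i (?D j p))"
  have p: "\<forall>m\<in>Poly_Mapping.keys p. Poly_Mapping.keys m \<subseteq> X" "homogeneous (length ws + 3) p"
    "\<forall>m. 0 \<le> Poly_Mapping.lookup p m" "M_convex (Poly_Mapping.keys p)"
    using Cons.prems(1) unfolding hereditarily_hyperbolic_def by (simp_all add: numeral_3_eq_3)
  have swap: "?D l (?D i (?D j p)) = ?D i (?D j (?D l p))" for l i j
    using partial_derivative_commute[of l i "?D j p"] partial_derivative_commute[of l j p] by simp
  show ?case
  proof (rule trickle_down[of X w "\<lambda>l i j. directional X ws (?D l (?D i (?D j p)))"])
    fix l assume "l \<in> X"
    have "hereditarily_hyperbolic X (length ws + 2) (?D l p)"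
      using hereditarily_hyperbolic_partial_derivative[of X "length ws + 2" p l] Cons.prems(1) \<open>l \<in> X\<close>
      by simp
    then show "hyperbolic X (\<lambda>i j. directional X ws (?D l (?D i (?D j p))))"
      unfolding swap using Cons.prems(2) by (intro Cons.IH) auto
  next
    fix l i j
    show "0 \<le> directional X ws (?D l (?D i (?D j p)))"
      using Cons.prems(2) p(3) by (intro directional_nonneg) (auto simp: nonneg_partial_derivative)
  next
    fix S i j a b
    assume S: "S \<subseteq> X" "i \<in> S" "j \<in> X - S" and "a \<in> X" "b \<in> X" and h: "0 < ?h i a" "0 < ?h j b"
    have key: "\<exists>m\<in>Poly_Mapping.keys p. 0 < Poly_Mapping.lookup m i" if "0 < ?h i a" for i a
    proof -
      have "?D i (?D a p) \<noteq> 0" using that by (auto simp del: directional.simps)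
      then obtain m where "m \<in> Poly_Mapping.keys (?D i (?D a p))" by fastforce
      then show ?thesis
        unfolding keys_partial_derivative by (intro bexI[of _ "m + e1 i + e1 a"]) (auto simp: lookup_add)
    qed
    obtain \<alpha> \<beta> where "\<alpha> \<in> Poly_Mapping.keys p" "0 < Poly_Mapping.lookup \<alpha> i"
      "\<beta> \<in> Poly_Mapping.keys p" "0 < Poly_Mapping.lookup \<beta> j"
      using key[OF h(1)] key[OF h(2)] by blast
    moreover have "2 \<le> mon_degree m \<and> Poly_Mapping.keys m \<subseteq> X" if "m \<in> Poly_Mapping.keys p" for m
      using p(1,2) that by (simp add: homogeneous_def)
    ultimately obtain m i' j' where m: "m \<in> Poly_Mapping.keys p" and ij: "i' \<in> S" "j' \<in> X - S"
      "0 < Poly_Mapping.lookup m i'" "0 < Poly_Mapping.lookup m j'"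
      using M_convex_mixed_monomial[OF p(4), of X \<alpha> i S \<beta> j] S(2,3) by blast
    have i'_pos: "0 < Poly_Mapping.lookup (m - e1 j') i'" using ij by (auto simp: lookup_minus lookup_single when_def)
    have "m - e1 j' - e1 i' \<in> Poly_Mapping.keys (?D i' (?D j' p))"
      unfolding keys_partial_derivative monomial_minus_e1[OF i'_pos] monomial_minus_e1[OF ij(4)] by (rule m)
    then have "0 < directional X (w # ws) (?D i' (?D j' p))"
    proof (intro directional_pos[OF assms(1)])
      show "homogeneous (length (w # ws)) (?D i' (?D j' p))"
        using p(2) by (intro homogeneous_partial_derivative) (simp add: numeral_3_eq_3)
      show "\<forall>m\<in>Poly_Mapping.keys (?D i' (?D j' p)). Poly_Mapping.keys m \<subseteq> X"
        by (intro keys_subset_partial_derivative p(1))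
    qed (use Cons.prems(2) p(3) in \<open>simp_all add: nonneg_partial_derivative\<close>)
    then show "\<exists>i'\<in>S. \<exists>j'\<in>X - S. 0 < ?h i' j'" using ij by blast
  next
    show "directional X ws (?D l (?D i (?D j p))) = directional X ws (?D l (?D j (?D i p)))" for l i j
      by (simp add: partial_derivative_commute[of i j p])
    show "directional X ws (?D l (?D i (?D j p))) = directional X ws (?D i (?D l (?D j p)))" for l i j
      by (simp add: partial_derivative_commute[of i l "?D j p"])
    show "0 < w i" if "i \<in> X" for i using Cons.prems(2) that by simp
  qed (use assms(1) in simp_all)
qed

lemma directional_tendsto:
  "((\<lambda>\<epsilon>. directional X (map (\<lambda>w i. w i + \<epsilon>) ws) p) \<longlongrightarrow> directional X ws p) (at_right 0)"
proof (induction ws arbitrary: p)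
  case (Cons w ws)
  have "((\<lambda>\<epsilon>. \<Sum>l\<in>X. (w l + \<epsilon>) * directional X (map (\<lambda>w i. w i + \<epsilon>) ws) (partial_derivative l p))
      \<longlongrightarrow> (\<Sum>l\<in>X. (w l + 0) * directional X ws (partial_derivative l p))) (at_right 0)"
    by (intro tendsto_intros Cons.IH)
  then show ?case by simp
qed simp

text \<open>Shifting all directions by \<open>\<epsilon>\<close> makes them positive, where the inequality is the hyperbolicity
  of the form; then \<open>\<epsilon>\<close> tends to 0.\<close>
lemma directional_log_concave:
  assumes fin: "finite X" and p: "hereditarily_hyperbolic X (length ws + 2) p"
    and nonneg: "\<And>w i. w \<in> set (u # v # ws) \<Longrightarrow> i \<in> X \<Longrightarrow> 0 \<le> w i"
  shows "directional X (u # u # ws) p * directional X (v # v # ws) p \<le> (directional X (u # v # ws) p)\<^sup>2"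
proof -
  let ?f = "\<lambda>\<epsilon> vs. directional X (map (\<lambda>w i. w i + \<epsilon>) vs) p"
  have "?f \<epsilon> (u # u # ws) * ?f \<epsilon> (v # v # ws) \<le> (?f \<epsilon> (u # v # ws))\<^sup>2" if "0 < \<epsilon>" for \<epsilon> :: real
  proof -
    let ?g = "\<lambda>w i. w i + \<epsilon>"
    define h where "h i j = directional X (map ?g ws) (partial_derivative i (partial_derivative j p))" for i j
    have pos: "0 < ?g w i" if "w \<in> set (u # v # ws)" "i \<in> X" for w i
      using nonneg[OF that] \<open>0 < \<epsilon>\<close> by linarith
    have form: "directional X (x # y # map ?g ws) p = bform X h x y" for x y
      unfolding directional_form h_def ..
    have hyp: "hyperbolic X h"
      unfolding h_def
    proof (rule hyperbolic_directional[OF fin])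
      show "hereditarily_hyperbolic X (length (map ?g ws) + 2) p" using p by simp
      show "0 < w i" if "w \<in> set (map ?g ws)" "i \<in> X" for w i
        using that pos by auto
    qed
    have "0 \<le> directional X (?g u # ?g u # map ?g ws) p"
    proof (rule directional_nonneg)
      show "0 < w i" if "w \<in> set (?g u # ?g u # map ?g ws)" "i \<in> X" for w i
        using that pos by auto
      show "\<forall>m. 0 \<le> Poly_Mapping.lookup p m" using p unfolding hereditarily_hyperbolic_def by blast
    qed
    then have "0 \<le> bform X h (?g u) (?g u)" unfolding form .
    then have "bform X h (?g u) (?g u) * bform X h (?g v) (?g v) \<le> (bform X h (?g u) (?g v))\<^sup>2"
      using hyp[unfolded hyperbolic_def, rule_format, of "?g u" "?g v"]
      by (cases "bform X h (?g u) (?g u) = 0") simp_all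
    then show ?thesis unfolding list.map form .
  qed
  then have "\<forall>\<^sub>F \<epsilon> in at_right 0. ?f \<epsilon> (u # u # ws) * ?f \<epsilon> (v # v # ws) \<le> (?f \<epsilon> (u # v # ws))\<^sup>2"
    by (rule eventually_mono[OF eventually_at_right_less])
  then show ?thesis
    by (rule tendsto_le[OF trivial_limit_at_right_real
          tendsto_power[OF directional_tendsto] tendsto_mult[OF directional_tendsto directional_tendsto]])
qed

section \<open>Specialisation to two variables\<close>

text \<open>Coefficient extraction and derivatives of polynomials are both linear in the polynomial; with the
  linear functional that takes a prescribed value on each monomial, such identities need to be
  checked on monomials only.\<close>
definition linear_extension :: "('x mon \<Rightarrow> real) \<Rightarrow> 'x polynomial \<Rightarrow> real" where
  "linear_extension \<phi> p = (\<Sum>m\<in>Poly_Mapping.keys p. Poly_Mapping.lookup p m * \<phi> m)"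

lemma linear_extension_superset:
  assumes "finite A" "Poly_Mapping.keys p \<subseteq> A"
  shows "linear_extension \<phi> p = (\<Sum>m\<in>A. Poly_Mapping.lookup p m * \<phi> m)"
  unfolding linear_extension_def using assms
  by (intro sum.mono_neutral_left) (auto simp: in_keys_iff)

lemma linear_extension_add:
  "linear_extension \<phi> (p + q) = linear_extension \<phi> p + linear_extension \<phi> q"
proof -
  let ?A = "Poly_Mapping.keys p \<union> Poly_Mapping.keys q"
  have "linear_extension \<phi> (p + q) = (\<Sum>m\<in>?A. Poly_Mapping.lookup (p + q) m * \<phi> m)"
    using keys_add[of p q] by (intro linear_extension_superset) auto
  then show ?thesis
    by (simp add: lookup_add distrib_right sum.distrib
        linear_extension_superset[of ?A p] linear_extension_superset[of ?A q])
qed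

lemma linear_extension_sum:
  "linear_extension \<phi> (\<Sum>i\<in>I. f i) = (\<Sum>i\<in>I. linear_extension \<phi> (f i))"
proof (induction I rule: infinite_finite_induct)
  case (insert i I)
  then show ?case by (simp add: linear_extension_add)
qed (simp_all add: linear_extension_def)

lemma linear_extension_single [simp]:
  "linear_extension \<phi> (Poly_Mapping.single m c) = c * \<phi> m"
  by (simp add: linear_extension_def)

lemma linear_extension_cong:
  assumes "\<And>m. m \<in> Poly_Mapping.keys p \<Longrightarrow> \<phi> m = \<psi> m"
  shows "linear_extension \<phi> p = linear_extension \<psi> p"
  unfolding linear_extension_def using assms by simp

lemma linear_extension_scale:
  "linear_extension (\<lambda>m. c * \<phi> m) p = c * linear_extension \<phi> p"
  unfolding linear_extension_def by (simp add: sum_distrib_left mult_ac)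

lemma linear_extension_partial_derivative:
  "linear_extension \<phi> (partial_derivative l p) =
     linear_extension (\<lambda>m. real (Poly_Mapping.lookup m l) * \<phi> (m - e1 l)) p"
  unfolding partial_derivative_def linear_extension_sum linear_extension_single
  by (simp add: linear_extension_def mult_ac)

lemma linear_extension_monomial_mult:
  "linear_extension \<phi> (Poly_Mapping.single n 1 * p) = linear_extension (\<lambda>m. \<phi> (n + m)) p"
proof -
  have p: "p = (\<Sum>m\<in>Poly_Mapping.keys p. Poly_Mapping.single m (Poly_Mapping.lookup p m))"
    by (rule poly_mapping_eqI) (simp add: lookup_sum lookup_single when_def in_keys_iff)
  have "linear_extension \<phi> (Poly_Mapping.single n 1 * p) =
      linear_extension \<phi> (\<Sum>m\<in>Poly_Mapping.keys p. Poly_Mapping.single (n + m) (Poly_Mapping.lookup p m))"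
    by (subst p) (simp add: sum_distrib_left mult_single)
  then show ?thesis
    unfolding linear_extension_sum linear_extension_single by (simp add: linear_extension_def)
qed

text \<open>The entries of \<open>cs\<close> choose between the direction of \<open>y\<close> (for \<open>True\<close>) and the sum of all other
  coordinate directions (for \<open>False\<close>). On the sum of all coefficients with a given exponent of \<open>y\<close>,
  differentiating in the second direction acts as multiplication by the degree in the other
  variables, just as if these had been identified.\<close>
lemma directional_two_directions:
  assumes fin: "finite X" and y: "y \<in> X"
    and "homogeneous (length cs) p" "\<forall>m\<in>Poly_Mapping.keys p. Poly_Mapping.keys m \<subseteq> X"
  shows "directional X (map (\<lambda>c x. of_bool ((x = y) = c)) cs) p =
    fact (count_list cs False) * fact (count_list cs True) *
    linear_extension (\<lambda>m. of_bool (Poly_Mapping.lookup m y = count_list cs True)) p"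
  using assms(3,4)
proof (induction cs arbitrary: p)
  case Nil
  have deg0: "m = 0" if "m \<in> Poly_Mapping.keys p" for m
    using that Nil by (intro poly_mapping_eqI) (auto simp: homogeneous_def mon_degree_def in_keys_iff)
  have "linear_extension (\<lambda>m. of_bool (Poly_Mapping.lookup m y = 0)) p =
      (\<Sum>m\<in>{0}. Poly_Mapping.lookup p m * of_bool (Poly_Mapping.lookup m y = 0))"
    using deg0 by (intro linear_extension_superset) auto
  then show ?case by simp
next
  case (Cons c cs)
  let ?a = "count_list cs False" and ?b = "count_list cs True"
  let ?ind = "\<lambda>c x. of_bool ((x = y) = c)"
  have len: "?a + ?b = length cs" by (induction cs) auto
  have IH: "directional X (map ?ind cs) (partial_derivative l p) = fact ?a * fact ?b *
      linear_extension (\<lambda>m. real (Poly_Mapping.lookup m l) * of_bool (Poly_Mapping.lookup (m - e1 l) y = ?b)) p"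
    for l
    using Cons.IH[of "partial_derivative l p"] Cons.prems
    by (simp add: homogeneous_partial_derivative keys_subset_partial_derivative
        linear_extension_partial_derivative)
  show ?case
  proof (cases c)
    case True
    have dir: "directional X (map ?ind (c # cs)) p = directional X (map ?ind cs) (partial_derivative y p)"
      unfolding list.map directional.simps sum.remove[OF fin y] using True by simp
    have lin: "linear_extension (\<lambda>m. real (Poly_Mapping.lookup m y) * of_bool (Poly_Mapping.lookup (m - e1 y) y = ?b)) p =
        linear_extension (\<lambda>m. real (Suc ?b) * of_bool (Poly_Mapping.lookup m y = Suc ?b)) p"
      by (intro linear_extension_cong) (auto simp: lookup_minus)
    show ?thesis
      unfolding dir IH lin linear_extension_scale using True by simp
  next
    case False
    have "directional X (map ?ind (c # cs)) p =
        (\<Sum>l\<in>X - {y}. directional X (map ?ind cs) (partial_derivative l p))"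
      unfolding list.map directional.simps sum.remove[OF fin y] using False by simp
    also have "\<dots> = fact ?a * fact ?b * (\<Sum>l\<in>X - {y}.
        linear_extension (\<lambda>m. real (Poly_Mapping.lookup m l) * of_bool (Poly_Mapping.lookup m y = ?b)) p)"
      unfolding IH sum_distrib_left
      by (intro sum.cong refl arg_cong2[where f = "(*)"] linear_extension_cong)
        (auto simp: lookup_minus lookup_single when_def)
    also have "(\<Sum>l\<in>X - {y}.
        linear_extension (\<lambda>m. real (Poly_Mapping.lookup m l) * of_bool (Poly_Mapping.lookup m y = ?b)) p) =
        linear_extension (\<lambda>m. real (\<Sum>l\<in>X - {y}. Poly_Mapping.lookup m l) * of_bool (Poly_Mapping.lookup m y = ?b)) p"
      unfolding linear_extension_def
      by (subst sum.swap) (simp add: sum_distrib_left sum_distrib_right)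
    also have "\<dots> = linear_extension (\<lambda>m. real (Suc ?a) * of_bool (Poly_Mapping.lookup m y = ?b)) p"
    proof (intro linear_extension_cong)
      fix m assume m: "m \<in> Poly_Mapping.keys p"
      have "mon_degree m = (\<Sum>l\<in>X. Poly_Mapping.lookup m l)"
        using Cons.prems(2) m fin by (intro mon_degree_superset) auto
      also have "\<dots> = Poly_Mapping.lookup m y + (\<Sum>l\<in>X - {y}. Poly_Mapping.lookup m l)"
        using fin y by (rule sum.remove)
      finally have "Poly_Mapping.lookup m y + (\<Sum>l\<in>X - {y}. Poly_Mapping.lookup m l) = Suc (?a + ?b)"
        using Cons.prems(1) m len by (simp add: homogeneous_def)
      then show "real (\<Sum>l\<in>X - {y}. Poly_Mapping.lookup m l) * of_bool (Poly_Mapping.lookup m y = ?b) =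
          real (Suc ?a) * of_bool (Poly_Mapping.lookup m y = ?b)"
        by (cases "Poly_Mapping.lookup m y = ?b") simp_all
    qed
    finally have dir: "directional X (map ?ind (c # cs)) p = fact ?a * fact ?b *
        linear_extension (\<lambda>m. real (Suc ?a) * of_bool (Poly_Mapping.lookup m y = ?b)) p" .
    show ?thesis
      unfolding dir linear_extension_scale using False by simp
  qed
qed

lemma ultra_log_concave:
  assumes "finite X" "y \<in> X" "hereditarily_hyperbolic X (a + b) p" "1 \<le> a" "1 \<le> b"
  defines "c \<equiv> \<lambda>r. linear_extension (\<lambda>m. of_bool (Poly_Mapping.lookup m y = r)) p"
  shows "(fact (a + 1) * fact (b - 1) * c (b - 1)) * (fact (a - 1) * fact (b + 1) * c (b + 1))
    \<le> (fact a * fact b * c b)\<^sup>2"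
proof -
  let ?ind = "\<lambda>c x. of_bool ((x = y) = c) :: real"
  define cs where "cs = replicate (a - 1) False @ replicate (b - 1) True"
  have replicate: "count_list (replicate n s) t = (if s = t then n else 0)" for n and s t :: bool
    by (induction n) auto
  have count: "count_list cs False = a - 1" "count_list cs True = b - 1"
    unfolding cs_def by (simp_all add: replicate)
  have len: "length cs + 2 = a + b" using assms(4,5) by (simp add: cs_def)
  have two: "directional X (?ind s # ?ind t # map ?ind cs) p =
      fact (count_list (s # t # cs) False) * fact (count_list (s # t # cs) True) * c (count_list (s # t # cs) True)"
    for s t
    using directional_two_directions[OF assms(1,2), of "s # t # cs" p] assms(3) len
    unfolding hereditarily_hyperbolic_def c_def by simp
  have "directional X (?ind False # ?ind False # map ?ind cs) p * directional X (?ind True # ?ind True # map ?ind cs) p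
      \<le> (directional X (?ind False # ?ind True # map ?ind cs) p)\<^sup>2"
    using assms(1,3) len by (intro directional_log_concave) auto
  then show ?thesis
    unfolding two using assms(4,5) by (simp add: count)
qed

text \<open>The factorials are log-convex.\<close>
lemma log_concave_of_ultra_log_concave:
  fixes x y z :: real
  assumes "1 \<le> a" "1 \<le> b" "0 \<le> x" "0 \<le> z"
    and "(fact (a + 1) * fact (b - 1) * x) * (fact (a - 1) * fact (b + 1) * z) \<le> (fact a * fact b * y)\<^sup>2"
  shows "x * z \<le> y\<^sup>2"
proof -
  have fact_le: "fact n * fact n \<le> fact (n + 1) * (fact (n - 1) :: real)" if "1 \<le> n" for n :: nat
    using that by (cases n) (simp_all add: algebra_simps)
  have "(fact a * fact a) * (fact b * fact b) * (x * z)
      \<le> (fact (a + 1) * fact (a - 1)) * (fact (b + 1) * fact (b - 1)) * (x * z)"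
    using assms by (intro mult_right_mono mult_mono fact_le) simp_all
  also have "\<dots> \<le> (fact a * fact b * y)\<^sup>2" using assms(5) by (simp add: mult_ac)
  also have "\<dots> = (fact a * fact a) * (fact b * fact b) * y\<^sup>2" by (simp add: power2_eq_square mult_ac)
  finally show ?thesis by simp
qed

section \<open>Counting independent sets\<close>

lemma linear_extension_coloured_independence_polynomial:
  assumes "finite V"
  shows "linear_extension (\<lambda>m. of_bool (mon_degree m = k)) (coloured_independence_polynomial V E i) =
     real (card {S \<in> independent_sets V E. card S = k})"
proof -
  have sub: "S \<subseteq> V" if "S \<in> independent_sets V E" for S using that by (simp add: independent_sets_def)
  have fin: "finite (independent_sets V E)"
    by (rule finite_subset[of _ "Pow V"]) (use sub assms in blast, use assms in simp)
  have mono: "(\<Prod>v\<in>S. var (i v)) = Poly_Mapping.single (\<Sum>v\<in>S. e1 (i v)) 1"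
    and deg: "mon_degree (\<Sum>v\<in>S. e1 (i v)) = card S" if "S \<in> independent_sets V E" for S
  proof -
    have "finite S" using sub[OF that] assms by (rule finite_subset)
    then show "(\<Prod>v\<in>S. var (i v)) = Poly_Mapping.single (\<Sum>v\<in>S. e1 (i v)) 1"
      unfolding var_def by (rule prod_single)
    show "mon_degree (\<Sum>v\<in>S. e1 (i v)) = card S"
      using \<open>finite S\<close>
    proof (induction S rule: finite_induct)
      case empty
      show ?case by (simp add: mon_degree_def)
    next
      case (insert v S)
      then show ?case by (simp add: mon_degree_add)
    qed
  qed
  have "linear_extension (\<lambda>m. of_bool (mon_degree m = k)) (coloured_independence_polynomial V E i) =
      (\<Sum>S\<in>independent_sets V E. of_bool (card S = k))"
    unfolding coloured_independence_polynomial_def linear_extension_sum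
  proof (intro sum.cong refl)
    fix S assume S: "S \<in> independent_sets V E"
    show "linear_extension (\<lambda>m. of_bool (mon_degree m = k)) (\<Prod>v\<in>S. var (i v)) = of_bool (card S = k)"
      unfolding mono[OF S] linear_extension_single deg[OF S] by simp
  qed
  also have "\<dots> = real (card {S \<in> independent_sets V E. card S = k})"
    using fin by (simp only: sum_of_bool_eq Collect_conj_eq Collect_mem_eq)
  finally show ?thesis .
qed

text \<open>A monomial of \<open>H(C)\<close> coming from an independent set of size \<open>r\<close> has exponent \<open>d - r\<close> at \<open>y\<close>, where
  \<open>d\<close> is the degree of \<open>H(C)\<close>, and exponent \<open>d + k - r\<close> after multiplication by \<open>(x y)\<^sup>k\<close>. So the
  numbers of independent sets are the coefficients of the two-variable specialisation.\<close>
lemma independent_sets_log_concave: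
  fixes i :: "'v \<Rightarrow> 'c"
  assumes "finite V" and "pre_lorentzian V E i b"
  defines "N \<equiv> \<lambda>k. real (card {S \<in> independent_sets V E. card S = k})"
  assumes "1 \<le> j"
  shows "N (j + 1) * N (j - 1) \<le> (N j)\<^sup>2"
proof -
  let ?C = "coloured_independence_polynomial V E i" and ?X = "insert None (Some ` insert b (i ` V))"
  define q where "q = homogenisation ?C"
  obtain d where d: "homogeneous d q" "set_y_to_1 q = ?C"
    using is_homogenisation_homogenisation[of ?C, folded q_def]
    unfolding is_homogenisation_def homogeneous_lift_def by (elim exE conjE)
  obtain k where k: "lorentzian ?X ((var (Some b) * var None) ^ k * q)"
    using assms(2) unfolding pre_lorentzian_def q_def by blast
  define \<mu> :: "'c option mon" where "\<mu> = Poly_Mapping.single (Some b) k + Poly_Mapping.single None k"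
  define P where "P = Poly_Mapping.single \<mu> 1 * q"
  have P: "(var (Some b) * var None) ^ k * q = P"
    unfolding P_def \<mu>_def power_mult_distrib var_power by (simp add: mult_single)
  obtain D where fin: "finite ?X" and hh: "hereditarily_hyperbolic ?X D P"
    by (rule hereditarily_hyperbolic_if_lorentzian[OF k[unfolded P]])
  have N_q: "N r = linear_extension (\<lambda>n. of_bool (mon_degree (Poly_Mapping.map_key Some n) = r)) q" for r
  proof -
    have "N r = linear_extension (\<lambda>m. of_bool (mon_degree m = r)) (set_y_to_1 q)"
      unfolding N_def d(2) linear_extension_coloured_independence_polynomial[OF assms(1)] ..
    then show ?thesis
      unfolding set_y_to_1_eq linear_extension_sum linear_extension_single by (simp add: linear_extension_def)
  qed
  have deg_q: "Poly_Mapping.lookup n None + mon_degree (Poly_Mapping.map_key Some n) = d"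
    if "n \<in> Poly_Mapping.keys q" for n
    using that d(1) mon_degree_option[of n] by (simp add: homogeneous_def)
  have N_P: "N r = linear_extension (\<lambda>m. of_bool (Poly_Mapping.lookup m None = d + k - r)) P"
    if "r \<le> d" for r
    unfolding P_def linear_extension_monomial_mult N_q
  proof (rule linear_extension_cong)
    fix n assume "n \<in> Poly_Mapping.keys q"
    moreover have "Poly_Mapping.lookup (\<mu> + n) None = k + Poly_Mapping.lookup n None"
      by (simp add: \<mu>_def lookup_add lookup_single)
    ultimately have "mon_degree (Poly_Mapping.map_key Some n) = r \<longleftrightarrow>
        Poly_Mapping.lookup (\<mu> + n) None = d + k - r"
      using deg_q[of n] that by auto
    then show "(of_bool (mon_degree (Poly_Mapping.map_key Some n) = r) :: real) =
        of_bool (Poly_Mapping.lookup (\<mu> + n) None = d + k - r)" by simp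
  qed
  have N_zero: "N r = 0" if "d < r" for r
  proof -
    have "N r = linear_extension (\<lambda>n. 0) q"
      unfolding N_q
    proof (rule linear_extension_cong)
      fix n assume "n \<in> Poly_Mapping.keys q"
      then show "of_bool (mon_degree (Poly_Mapping.map_key Some n) = r) = (0 :: real)"
        using deg_q[of n] that by simp
    qed
    then show ?thesis by (simp add: linear_extension_def)
  qed
  show ?thesis
  proof (cases "j + 1 \<le> d \<and> P \<noteq> 0")
    case False
    moreover have "N r = 0" if "P = 0" for r
      using N_zero[of r] N_P[of r] that by (cases "r \<le> d") (simp_all add: linear_extension_def)
    ultimately show ?thesis using N_zero[of "j + 1"] by auto
  next
    case True
    then obtain m where m: "m \<in> Poly_Mapping.keys P" by fastforce
    then obtain n where n: "n \<in> Poly_Mapping.keys q" "m = \<mu> + n"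
      unfolding P_def using keys_mult[of "Poly_Mapping.single \<mu> 1" q] by fastforce
    have "homogeneous D P" using hh unfolding hereditarily_hyperbolic_def by (elim conjE)
    then have "D = mon_degree m" using m by (simp add: homogeneous_def)
    also have "\<dots> = d + 2 * k" using n d(1) by (simp add: mon_degree_add \<mu>_def homogeneous_def)
    finally have D: "D = (j + k) + (d + k - j)" using True by simp
    let ?a = "j + k" and ?b = "d + k - j"
    have ab: "1 \<le> ?a" "1 \<le> ?b" using True \<open>1 \<le> j\<close> by linarith+
    let ?c = "\<lambda>r. linear_extension (\<lambda>m. of_bool (Poly_Mapping.lookup m None = r)) P"
    have le: "j + 1 \<le> d" "j - 1 \<le> d" "j \<le> d" using True by linarith+
    have "d + k - (j + 1) = ?b - 1" "d + k - (j - 1) = ?b + 1" using True \<open>1 \<le> j\<close> by linarith+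
    then have N: "N (j + 1) = ?c (?b - 1)" "N (j - 1) = ?c (?b + 1)" "N j = ?c ?b"
      using N_P[OF le(1)] N_P[OF le(2)] N_P[OF le(3)] by simp_all
    have "(fact (?a + 1) * fact (?b - 1) * N (j + 1)) * (fact (?a - 1) * fact (?b + 1) * N (j - 1))
        \<le> (fact ?a * fact ?b * N j)\<^sup>2"
      unfolding N by (rule ultra_log_concave[OF fin _ hh[unfolded D] ab]) simp
    then show ?thesis
      by (rule log_concave_of_ultra_log_concave[OF ab, rotated 2]) (simp_all add: N_def)
  qed
qed

theorem lemma3p15:
  fixes V :: "'v set" and E :: "'v set set" and i :: "'v \<Rightarrow> 'c" and b :: 'c
  assumes "partitioned_graph V E i b"
    and "pre_lorentzian V E i b"
  shows "log_concave (independence_sequence V E)"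
proof -
  have "finite V"
    using assms(1) unfolding partitioned_graph_def simple_graph_def by blast
  let ?s = "independence_sequence V E"
  have nth: "?s ! j = real (card {S \<in> independent_sets V E. card S = j})" if "j < length ?s" for j
    using that unfolding independence_sequence_def by (simp del: upt_Suc)
  have "?s ! (j - 1) * ?s ! (j + 1) \<le> (?s ! j)\<^sup>2" if "1 \<le> j" "Suc j < length ?s" for j
    using independent_sets_log_concave[OF \<open>finite V\<close> assms(2) \<open>1 \<le> j\<close>] that
      nth[of "j - 1"] nth[of j] nth[of "j + 1"] by (simp add: mult.commute)
  moreover have "\<forall>x\<in>set ?s. 0 \<le> x"
    unfolding independence_sequence_def by auto
  ultimately show ?thesis unfolding log_concave_def by simp
qed

end
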